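(* Let $T$ be a locally finite tree without vertices of valency one, and let $G \leq \mathrm{Aut}(T)$ be a closed subgroup acting transitively on the set of ends $\partial T$. Assume that for some hyperbolic element $\alpha \in G$, the contraction group $U_\alpha$ is closed. Then $G$ is boundary-Moufang. Moreover, the system of root groups in $G$ is unique in the following sense: for any conjugacy class $(V_\xi)_{\xi \in \partial T}$ of closed subgroups of $G$ (indexed by $\partial T$) satisfying the Moufang condition, the groups $V_\xi$ are conjugate to $U_\alpha$.
   Context: $\mathrm{Aut}(T)$ is endowed with the compact-open topology, for which it is a second countable totally disconnected locally compact group. For $\alpha \in G$, the contraction group is $U_\alpha = \{ g \in G \mid \lim_{n \to \infty} \alpha^n g \alpha^{-n} = 1\}$. An automorphism of $T$ is hyperbolic if it acts as a non-trivial translation along a bi-infinite geodesic line of $T$. A family $(U_\xi)_{\xi \in \partial T}$ of subgroups satisfies the Moufang condition if, for each $\xi \in \partial T$, the group $U_\xi$ fixes $\xi$ and acts sharply transitively (i.e. transitively and freely) on $\partial T \setminus \{\xi\}$. A subgroup $G \leq \mathrm{Aut}(T)$ is called boundary-Moufang if $G$ is closed and possesses a full conjugacy class $(U_\xi)_{\xi \in \partial T}$ of closed subgroups indexed by $\partial T$, called root groups, satisfying the Moufang condition. *)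

theory Defs
  imports "HOL-Analysis.Analysis" "HOL-Algebra.Group" "HOL-Combinatorics.Permutations"
begin

section \<open>Trees\<close>

text \<open>
  A graph is given by its vertex set \<open>V\<close> and a symmetric irreflexive adjacency relation \<open>E\<close> on
  \<open>V\<close>. Cycles have at least three vertices, so traversing an edge back and forth is not a cycle.
\<close>

definition is_cycle :: "('v \<times> 'v) set \<Rightarrow> 'v list \<Rightarrow> bool" where
  "is_cycle E p \<longleftrightarrow> length p \<ge> 3 \<and> distinct p \<and>
     successively (\<lambda>x y. (x, y) \<in> E) p \<and> (last p, hd p) \<in> E"

definition is_tree :: "'v set \<Rightarrow> ('v \<times> 'v) set \<Rightarrow> bool" where
  "is_tree V E \<longleftrightarrow> V \<noteq> {} \<and> E \<subseteq> V \<times> V \<and> sym E \<and> irrefl E \<and>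
     (\<forall>x\<in>V. \<forall>y\<in>V. (x, y) \<in> E\<^sup>*) \<and> (\<nexists>p. is_cycle E p)"

definition locally_finite_graph :: "'v set \<Rightarrow> ('v \<times> 'v) set \<Rightarrow> bool" where
  "locally_finite_graph V E \<longleftrightarrow> (\<forall>v\<in>V. finite (E `` {v}))"

definition valency :: "('v \<times> 'v) set \<Rightarrow> 'v \<Rightarrow> nat" where
  "valency E v = card (E `` {v})"

definition graph_dist :: "('v \<times> 'v) set \<Rightarrow> 'v \<Rightarrow> 'v \<Rightarrow> nat" where
  "graph_dist E x y = (LEAST n. (x, y) \<in> E ^^ n)"

definition geodesic_line :: "'v set \<Rightarrow> ('v \<times> 'v) set \<Rightarrow> (int \<Rightarrow> 'v) \<Rightarrow> bool" where
  "geodesic_line V E l \<longleftrightarrow> range l \<subseteq> V \<and> (\<forall>i j. graph_dist E (l i) (l j) = nat \<bar>i - j\<bar>)"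


section \<open>The space of ends\<close>

definition rays :: "'v set \<Rightarrow> ('v \<times> 'v) set \<Rightarrow> (nat \<Rightarrow> 'v) set" where
  "rays V E = {r. range r \<subseteq> V \<and> (\<forall>i j. graph_dist E (r i) (r j) = nat \<bar>int i - int j\<bar>)}"

text \<open>In a tree, two rays are equivalent iff their intersection is a ray.\<close>

definition ray_equiv :: "'v set \<Rightarrow> ('v \<times> 'v) set \<Rightarrow> ((nat \<Rightarrow> 'v) \<times> (nat \<Rightarrow> 'v)) set" where
  "ray_equiv V E = {(r, s). r \<in> rays V E \<and> s \<in> rays V E \<and> (\<exists>m n. \<forall>k. r (m + k) = s (n + k))}"

definition ends :: "'v set \<Rightarrow> ('v \<times> 'v) set \<Rightarrow> (nat \<Rightarrow> 'v) set set" where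
  "ends V E = rays V E // ray_equiv V E"

definition end_act :: "('v \<Rightarrow> 'v) \<Rightarrow> (nat \<Rightarrow> 'v) set \<Rightarrow> (nat \<Rightarrow> 'v) set" where
  "end_act g \<xi> = (\<lambda>r. g \<circ> r) ` \<xi>"

definition transitive_on_set ::
    "('v \<Rightarrow> 'v) set \<Rightarrow> (nat \<Rightarrow> 'v) set set \<Rightarrow> bool" where
  "transitive_on_set H \<Omega> \<longleftrightarrow> (\<forall>\<eta>\<in>\<Omega>. \<forall>\<zeta>\<in>\<Omega>. \<exists>h\<in>H. end_act h \<eta> = \<zeta>)"

definition free_on_set ::
    "('v \<Rightarrow> 'v) set \<Rightarrow> (nat \<Rightarrow> 'v) set set \<Rightarrow> bool" where
  "free_on_set H \<Omega> \<longleftrightarrow> (\<forall>h\<in>H. \<forall>\<eta>\<in>\<Omega>. end_act h \<eta> = \<eta> \<longrightarrow> h = id)"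


section \<open>The topological group of automorphisms\<close>

text \<open>
  Automorphisms are extended to the whole type by the identity outside \<open>V\<close> (this is part of
  \<open>permutes\<close>), so that equality of functions is equality of automorphisms.
\<close>

definition aut_group :: "'v set \<Rightarrow> ('v \<times> 'v) set \<Rightarrow> ('v \<Rightarrow> 'v) monoid" where
  "aut_group V E =
     \<lparr>carrier = {f. f permutes V \<and> (\<forall>x\<in>V. \<forall>y\<in>V. (f x, f y) \<in> E \<longleftrightarrow> (x, y) \<in> E)},
      mult = (\<circ>), one = id\<rparr>"

text \<open>
  The compact-open topology for the action on the discrete space \<open>V\<close>. For a locally finite tree
  it agrees with the compact-open topology for the action on the geometric realisation.
\<close>

definition compact_open_subbase :: "'v topology \<Rightarrow> ('v \<Rightarrow> 'v) set set" where
  "compact_open_subbase X = {{f. f ` K \<subseteq> W} | K W. compactin X K \<and> openin X W}"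

definition aut_topology :: "'v set \<Rightarrow> ('v \<times> 'v) set \<Rightarrow> ('v \<Rightarrow> 'v) topology" where
  "aut_topology V E =
     subtopology (topology_generated_by (compact_open_subbase (discrete_topology V)))
       (carrier (aut_group V E))"

definition hyperbolic :: "'v set \<Rightarrow> ('v \<times> 'v) set \<Rightarrow> ('v \<Rightarrow> 'v) \<Rightarrow> bool" where
  "hyperbolic V E g \<longleftrightarrow> g \<in> carrier (aut_group V E) \<and>
     (\<exists>l k. geodesic_line V E l \<and> k \<noteq> 0 \<and> (\<forall>i. g (l i) = l (i + k)))"

definition contraction_group ::
    "'v set \<Rightarrow> ('v \<times> 'v) set \<Rightarrow> ('v \<Rightarrow> 'v) set \<Rightarrow> ('v \<Rightarrow> 'v) \<Rightarrow> ('v \<Rightarrow> 'v) set" where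
  "contraction_group V E G \<alpha> =
     (let A = aut_group V E in
      {g \<in> G. limitin (aut_topology V E)
               (\<lambda>n::nat. \<alpha> [^]\<^bsub>A\<^esub> n \<otimes>\<^bsub>A\<^esub> g \<otimes>\<^bsub>A\<^esub> inv\<^bsub>A\<^esub> (\<alpha> [^]\<^bsub>A\<^esub> n)) \<one>\<^bsub>A\<^esub> sequentially})"

definition conj_by ::
    "'v set \<Rightarrow> ('v \<times> 'v) set \<Rightarrow> ('v \<Rightarrow> 'v) \<Rightarrow> ('v \<Rightarrow> 'v) set \<Rightarrow> ('v \<Rightarrow> 'v) set" where
  "conj_by V E g H =
     (let A = aut_group V E in (\<lambda>h. g \<otimes>\<^bsub>A\<^esub> h \<otimes>\<^bsub>A\<^esub> inv\<^bsub>A\<^esub> g) ` H)"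


section \<open>Root groups\<close>

definition moufang_condition ::
    "'v set \<Rightarrow> ('v \<times> 'v) set \<Rightarrow> ((nat \<Rightarrow> 'v) set \<Rightarrow> ('v \<Rightarrow> 'v) set) \<Rightarrow> bool" where
  "moufang_condition V E U \<longleftrightarrow>
     (\<forall>\<xi>\<in>ends V E.
        (\<forall>u\<in>U \<xi>. end_act u \<xi> = \<xi>) \<and>
        transitive_on_set (U \<xi>) (ends V E - {\<xi>}) \<and>
        free_on_set (U \<xi>) (ends V E - {\<xi>}))"

text \<open>
  The members of the family are required to make up exactly one conjugacy class of subgroups of
  \<open>G\<close>; no compatibility of the indexing with the action of \<open>G\<close> on the ends is assumed.
\<close>

definition conjugacy_class_family ::
    "'v set \<Rightarrow> ('v \<times> 'v) set \<Rightarrow> ('v \<Rightarrow> 'v) set \<Rightarrow> ((nat \<Rightarrow> 'v) set \<Rightarrow> ('v \<Rightarrow> 'v) set) \<Rightarrow> bool" where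
  "conjugacy_class_family V E G U \<longleftrightarrow>
     (\<exists>H. subgroup H ((aut_group V E)\<lparr>carrier := G\<rparr>) \<and>
          U ` ends V E = {conj_by V E g H | g. g \<in> G})"

definition root_group_system ::
    "'v set \<Rightarrow> ('v \<times> 'v) set \<Rightarrow> ('v \<Rightarrow> 'v) set \<Rightarrow> ((nat \<Rightarrow> 'v) set \<Rightarrow> ('v \<Rightarrow> 'v) set) \<Rightarrow> bool" where
  "root_group_system V E G U \<longleftrightarrow>
     (\<forall>\<xi>\<in>ends V E. subgroup (U \<xi>) ((aut_group V E)\<lparr>carrier := G\<rparr>) \<and>
                    closedin (aut_topology V E) (U \<xi>)) \<and>
     conjugacy_class_family V E G U \<and>
     moufang_condition V E U"

definition boundary_Moufang ::
    "'v set \<Rightarrow> ('v \<times> 'v) set \<Rightarrow> ('v \<Rightarrow> 'v) set \<Rightarrow> bool" where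
  "boundary_Moufang V E G \<longleftrightarrow>
     subgroup G (aut_group V E) \<and> closedin (aut_topology V E) G \<and>
     (\<exists>U. root_group_system V E G U)"

end

theory Submission
  imports Defs
begin

text \<open>
  Let \<open>\<xi>\<close> be the repelling end of \<open>\<alpha>\<close> and \<open>l\<close> its axis. An element of \<open>G\<close> is contracted by \<open>\<alpha>\<close> iff near
  \<open>\<xi>\<close> it fixes larger and larger balls around the vertices of the axis. So the contraction group
  depends on \<open>\<xi>\<close> alone; it is called the radical of \<open>\<xi>\<close> here (lemma
  \<open>contraction_group_eq_end_radical\<close>). Radicals of ends are conjugated as their ends are moved, hence they
  form a full conjugacy class if \<open>G\<close> is transitive on ends. They are the root groups; what has to be
  shown is that the radical of \<open>\<xi>\<close> acts sharply transitively on the ends other than \<open>\<xi>\<close>, and that no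
  other conjugacy class of closed subgroups satisfies the Moufang condition.

  Transitivity has two sources. First, a Baire argument shows that the orbit of the attracting end under
  the stabiliser of a vertex contains a neighbourhood of that end. Conjugating by negative powers of \<open>\<alpha>\<close>
  and passing to a limit, one finds for each end \<open>\<eta>\<close> other than \<open>\<xi>\<close> an element of \<open>G\<close> that fixes a
  ray towards \<open>\<xi>\<close> pointwise and maps the attracting end to \<open>\<eta>\<close> (\<open>backward_asymptotic_in_orbit\<close>).
  Secondly, each such element is the product of an element of the radical and an element fixing the
  axis pointwise, the latter not affecting the attracting end (\<open>half_tube_fixer_decomposition\<close>). The
  decomposition rests on a finiteness property of the compact group \<open>K\<close> of elements fixing a tube around
  the axis: an element of \<open>K\<close> that fixes a wider tube over a long enough window of the axis can be
  replaced, without change on the next block, by one that fixes the wider tube over any longer window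
  (\<open>window_extension\<close>). So local approximations by elements of \<open>K\<close> can be glued
  (\<open>half_tube_fixer_step\<close>).

  Freeness depends on the contraction group being closed. The elements of the radical that fix the
  attracting end fix the axis pointwise, so they form a compact group, each element of which \<open>\<alpha>\<close>
  contracts. The contraction is then uniform, and since \<open>\<alpha>\<close> normalises the group, it is trivial
  (\<open>axis_radical_trivial\<close>).

  For uniqueness let \<open>W\<close> be the root group at \<open>\<xi>\<close> of another system. It is normalised by \<open>\<alpha>\<close>. For \<open>w\<close>
  in \<open>W\<close>, every limit of the conjugates of \<open>w\<close> by positive powers of \<open>\<alpha>\<close> is an element of \<open>W\<close> fixing the
  attracting end, hence is trivial; so \<open>\<alpha>\<close> contracts \<open>w\<close>. Therefore \<open>W\<close> is contained in the radical,
  and both being sharply transitive, they are equal (\<open>root_group_eq_end_radical\<close>).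
\<close>

section \<open>Walks without backtracking\<close>

text \<open>
  A walk in a tree that never turns back is a geodesic. Being a ray or a line thereby becomes a
  condition on any three consecutive vertices, which survives cutting and pasting.
\<close>

definition nb_walk :: "('v \<times> 'v) set \<Rightarrow> nat \<Rightarrow> (nat \<Rightarrow> 'v) \<Rightarrow> bool" where
  "nb_walk E n w \<longleftrightarrow> (\<forall>i<n. (w i, w (Suc i)) \<in> E) \<and>
     (\<forall>i. Suc (Suc i) \<le> n \<longrightarrow> w i \<noteq> w (Suc (Suc i)))"

locale locally_finite_tree =
  fixes V :: "'v set" and E :: "('v \<times> 'v) set"
  assumes tree: "is_tree V E" and locally_finite: "locally_finite_graph V E"
begin

abbreviation "d \<equiv> graph_dist E"

lemma edge_in_V: "(x, y) \<in> E \<Longrightarrow> x \<in> V \<and> y \<in> V"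
  using tree unfolding is_tree_def by blast

lemma edge_sym: "(x, y) \<in> E \<Longrightarrow> (y, x) \<in> E"
  using tree unfolding is_tree_def by (meson symE)

text \<open>Between two visits of the same vertex that are as close as possible, the walk runs along a cycle.\<close>

lemma nb_walk_inj:
  assumes w: "nb_walk E n w"
  shows "i < j \<Longrightarrow> j \<le> n \<Longrightarrow> w i \<noteq> w j"
proof (induction "j - i" arbitrary: i j rule: less_induct)
  case less
  show ?case
  proof
    assume eq: "w i = w j"
    have e: "\<And>a. a < n \<Longrightarrow> (w a, w (Suc a)) \<in> E" using w by (simp add: nb_walk_def)
    have 1: "j \<noteq> Suc i"
      using e[of i] eq less tree by (auto simp: is_tree_def irrefl_def)
    have 2: "j \<noteq> Suc (Suc i)"
      using w eq less unfolding nb_walk_def by auto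
    define p where "p = map w [i..<j]"
    have len: "length p \<ge> 3" using 1 2 less by (simp add: p_def)
    have ne: "w a \<noteq> w b" if "i \<le> a" "a < b" "b < j" for a b
      using less.hyps[of b a] that less.prems by auto
    have "distinct p"
      unfolding p_def distinct_map
    proof (intro conjI inj_onI)
      fix x y assume "x \<in> set [i..<j]" "y \<in> set [i..<j]" "w x = w y"
      then show "x = y" using ne[of x y] ne[of y x] by (cases x y rule: linorder_cases) auto
    qed simp
    moreover have "successively (\<lambda>x y. (x, y) \<in> E) p"
      using e less.prems by (auto simp: p_def successively_conv_nth)
    moreover have "(last p, hd p) \<in> E"
      using e[of "j - 1"] less.prems eq by (simp add: p_def last_map hd_map)
    ultimately have "is_cycle E p" using len by (simp add: is_cycle_def)
    then show False using tree unfolding is_tree_def by blast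
  qed
qed

text \<open>
  Common last edges can be cut off. If the last edges differ, then one walk followed by the reverse of
  the other has no backtracking and returns to its first vertex.
\<close>

lemma nb_walk_unique:
  assumes "nb_walk E n a" "nb_walk E m b" "a 0 = b 0" "a n = b m"
  shows "n = m \<and> (\<forall>i\<le>n. a i = b i)"
  using assms
proof (induction n arbitrary: m)
  case 0
  then show ?case using nb_walk_inj[of m b 0 m] by (cases m) auto
next
  case (Suc n)
  show ?case
  proof (cases m)
    case 0
    then show ?thesis using Suc.prems nb_walk_inj[of "Suc n" a 0 "Suc n"] by auto
  next
    case (Suc m')
    show ?thesis
    proof (cases "a n = b m'")
      case True
      have "nb_walk E n a" "nb_walk E m' b"
        using Suc.prems \<open>m = Suc m'\<close> by (auto simp: nb_walk_def)
      from Suc.IH[OF this Suc.prems(3) True] Suc.prems \<open>m = Suc m'\<close> show ?thesis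
        by (auto simp: le_Suc_eq)
    next
      case False
      \<comment> \<open>\<open>a\<close>, then \<open>b\<close> backwards\<close>
      define c where "c i = (if i \<le> Suc n then a i else b (m - (i - Suc n)))" for i
      have A: "(a i, a (Suc i)) \<in> E" if "i < Suc n" for i
        using Suc.prems(1) that by (simp add: nb_walk_def)
      have A2: "a i \<noteq> a (Suc (Suc i))" if "i < n" for i
        using Suc.prems(1) that by (simp add: nb_walk_def)
      have B: "(b (m - i), b (m - Suc i)) \<in> E" if "i < m" for i
        using Suc.prems(2) that edge_sym[of "b (m - Suc i)" "b (m - i)"]
        by (auto simp: nb_walk_def dest!: spec[of _ "m - Suc i"] simp: Suc_diff_Suc)
      have B2: "b (m - i) \<noteq> b (m - Suc (Suc i))" if "Suc i < m" for i
      proof -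
        have "Suc (Suc (m - Suc (Suc i))) = m - i" using that by simp
        then show ?thesis using Suc.prems(2) that unfolding nb_walk_def
          by (metis diff_le_self)
      qed
      have "nb_walk E (Suc n + m) c"
        unfolding nb_walk_def
      proof (intro conjI allI impI)
        fix i assume i: "i < Suc n + m"
        show "(c i, c (Suc i)) \<in> E"
        proof (cases "i < Suc n")
          case True then show ?thesis using A by (simp add: c_def)
        next
          case F: False
          have "c i = b (m - (i - Suc n))" using F Suc.prems(4) by (auto simp: c_def)
          moreover have "c (Suc i) = b (m - Suc (i - Suc n))"
            using F by (auto simp: c_def Suc_diff_le)
          ultimately show ?thesis using B[of "i - Suc n"] i F by auto
        qed
      next
        fix i assume i: "Suc (Suc i) \<le> Suc n + m"
        consider "i < n" | "i = n" | "i > n" by linarith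
        then show "c i \<noteq> c (Suc (Suc i))"
        proof cases
          case 1 then show ?thesis using A2 by (simp add: c_def)
        next
          case 2 then show ?thesis using False \<open>m = Suc m'\<close> by (simp add: c_def)
        next
          case 3
          have "c i = b (m - (i - Suc n))"
            using 3 Suc.prems(4) by (cases "i = Suc n") (auto simp: c_def)
          moreover have "c (Suc (Suc i)) = b (m - Suc (Suc (i - Suc n)))"
          proof -
            have "Suc (Suc i) - Suc n = Suc (Suc (i - Suc n))" using 3 by simp
            then show ?thesis using 3 by (simp add: c_def)
          qed
          ultimately show ?thesis using B2[of "i - Suc n"] i 3 by auto
        qed
      qed
      moreover have "c 0 = c (Suc n + m)" using \<open>m = Suc m'\<close> Suc.prems(3) by (simp add: c_def)
      ultimately show ?thesis using nb_walk_inj[of "Suc n + m" c 0 "Suc n + m"] by simp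
    qed
  qed
qed

lemma dist_relpow:
  assumes "x \<in> V" "y \<in> V"
  shows "(x, y) \<in> E ^^ d x y"
proof -
  have "(x, y) \<in> E\<^sup>*" using tree assms unfolding is_tree_def by blast
  then show ?thesis unfolding graph_dist_def using rtrancl_imp_relpow by (metis LeastI)
qed

lemma dist_le: "(x, y) \<in> E ^^ n \<Longrightarrow> d x y \<le> n"
  unfolding graph_dist_def by (rule Least_le)

lemma relpow_sym: "(x, y) \<in> E ^^ n \<Longrightarrow> (y, x) \<in> E ^^ n"
proof (induction n arbitrary: y)
  case (Suc n)
  then obtain z where "(x, z) \<in> E ^^ n" "(z, y) \<in> E" by auto
  then show ?case using Suc.IH edge_sym by (meson relpow_Suc_I2)
qed auto

lemma dist_sym: "d x y = d y x"
  unfolding graph_dist_def using relpow_sym by metis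

lemma dist_self [simp]: "d x x = 0"
  unfolding graph_dist_def by (simp add: Least_eq_0)

lemma geodesic_exists:
  assumes "x \<in> V" "y \<in> V"
  shows "\<exists>w. nb_walk E (d x y) w \<and> w 0 = x \<and> w (d x y) = y"
proof -
  let ?n = "d x y"
  obtain w where w: "w 0 = x" "w ?n = y" "\<And>i. i < ?n \<Longrightarrow> (w i, w (Suc i)) \<in> E"
    using dist_relpow[OF assms] unfolding relpow_fun_conv by blast
  have "w i \<noteq> w (Suc (Suc i))" if "Suc (Suc i) \<le> ?n" for i
  proof
    assume eq: "w i = w (Suc (Suc i))"
    have "(x, w i) \<in> E ^^ i" unfolding relpow_fun_conv using w that by (intro exI[of _ w]) auto
    moreover have "Suc (Suc i) + (?n - Suc (Suc i)) = ?n" using that by simp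
    then have "(w (Suc (Suc i)), y) \<in> E ^^ (?n - Suc (Suc i))"
      unfolding relpow_fun_conv using w(2,3) that
      by (intro exI[of _ "\<lambda>k. w (Suc (Suc i) + k)"]) (simp del: add_Suc add: w)
    ultimately have "(x, y) \<in> E ^^ (i + (?n - Suc (Suc i)))"
      unfolding relpow_add using eq by auto
    then show False using dist_le that by fastforce
  qed
  then show ?thesis using w by (auto simp: nb_walk_def)
qed

lemma nb_walk_dist:
  assumes "nb_walk E n w" "w 0 \<in> V"
  shows "d (w 0) (w n) = n"
proof -
  have "w n \<in> V" using assms edge_in_V unfolding nb_walk_def
    by (cases n) auto
  then show ?thesis using geodesic_exists[OF assms(2)] nb_walk_unique[OF assms(1)] by metis
qed

lemma finite_ball:
  assumes "x \<in> V"
  shows "finite {v \<in> V. d x v \<le> R}"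
proof -
  have "finite ((E ^^ n) `` {x}) \<and> (E ^^ n) `` {x} \<subseteq> V" for n
  proof (induction n)
    case (Suc n)
    have "(E ^^ Suc n) `` {x} = (\<Union>y\<in>(E ^^ n) `` {x}. E `` {y})" by auto
    then show ?case using Suc locally_finite edge_in_V unfolding locally_finite_graph_def
      by auto
  qed (use assms in auto)
  moreover have "{v \<in> V. d x v \<le> R} \<subseteq> (\<Union>n\<le>R. (E ^^ n) `` {x})"
    using dist_relpow assms by force
  ultimately show ?thesis by (meson finite_UN_I finite_atMost finite_subset)
qed


section \<open>Rays, lines and ends\<close>

lemma edge_if_dist_1:
  assumes "x \<in> V" "y \<in> V" "d x y = 1"
  shows "(x, y) \<in> E"
  using dist_relpow[OF assms(1,2)] assms(3) by simp

lemma rays_iff: "r \<in> rays V E \<longleftrightarrow> (\<forall>i. (r i, r (Suc i)) \<in> E \<and> r i \<noteq> r (Suc (Suc i)))"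
proof
  assume r: "r \<in> rays V E"
  then have V: "r i \<in> V" for i by (auto simp: rays_def)
  have dd: "d (r i) (r j) = nat \<bar>int i - int j\<bar>" for i j using r by (simp add: rays_def)
  have "d (r i) (r (Suc i)) = 1" for i by (simp add: dd)
  moreover have "d (r i) (r (Suc (Suc i))) = 2" for i by (simp add: dd)
  ultimately show "\<forall>i. (r i, r (Suc i)) \<in> E \<and> r i \<noteq> r (Suc (Suc i))"
    using edge_if_dist_1 V by (metis dist_self zero_neq_numeral)
next
  assume r: "\<forall>i. (r i, r (Suc i)) \<in> E \<and> r i \<noteq> r (Suc (Suc i))"
  have 1: "d (r i) (r (i + n)) = n" for i n
    using nb_walk_dist[of n "\<lambda>k. r (i + k)"] r edge_in_V unfolding nb_walk_def by fastforce
  have "d (r i) (r j) = nat \<bar>int i - int j\<bar>" for i j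
  proof (cases "i \<le> j")
    case True then show ?thesis using 1[of i "j - i"] by simp
  next
    case False then show ?thesis using 1[of j "i - j"] dist_sym[of "r i" "r j"] by simp
  qed
  moreover have "range r \<subseteq> V" using r edge_in_V by auto
  ultimately show "r \<in> rays V E" by (simp add: rays_def)
qed

lemma geodesic_line_iff:
  "geodesic_line V E l \<longleftrightarrow> (\<forall>i. (l i, l (i + 1)) \<in> E \<and> l i \<noteq> l (i + 2))"
proof
  assume r: "geodesic_line V E l"
  then have V: "l i \<in> V" for i by (auto simp: geodesic_line_def)
  have dd: "d (l i) (l j) = nat \<bar>i - j\<bar>" for i j using r by (simp add: geodesic_line_def)
  have "d (l i) (l (i + 1)) = 1" for i by (simp add: dd)
  moreover have "d (l i) (l (i + 2)) = 2" for i by (simp add: dd)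
  ultimately show "\<forall>i. (l i, l (i + 1)) \<in> E \<and> l i \<noteq> l (i + 2)"
    using edge_if_dist_1 V by (metis dist_self zero_neq_numeral)
next
  assume r: "\<forall>i. (l i, l (i + 1)) \<in> E \<and> l i \<noteq> l (i + 2)"
  have V: "l i \<in> V" for i using r edge_in_V by blast
  have 1: "d (l i) (l (i + int n)) = n" for i n
  proof -
    have "nb_walk E n (\<lambda>k. l (i + int k))"
      unfolding nb_walk_def
    proof (intro conjI allI impI)
      fix j show "(l (i + int j), l (i + int (Suc j))) \<in> E"
        using r[rule_format, of "i + int j"] by (simp add: algebra_simps)
      show "l (i + int j) \<noteq> l (i + int (Suc (Suc j)))"
        using r[rule_format, of "i + int j"] by (simp add: algebra_simps)
    qed
    then show ?thesis using nb_walk_dist[of n "\<lambda>k. l (i + int k)"] V by auto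
  qed
  have "d (l i) (l j) = nat \<bar>i - j\<bar>" for i j
  proof (cases "i \<le> j")
    case True then show ?thesis using 1[of i "nat (j - i)"] by simp
  next
    case False then show ?thesis using 1[of j "nat (i - j)"] dist_sym[of "l i" "l j"] by simp
  qed
  then show "geodesic_line V E l" using V by (auto simp: geodesic_line_def)
qed

lemma line_in_V: "geodesic_line V E l \<Longrightarrow> l i \<in> V"
  by (auto simp: geodesic_line_def)

lemma line_inj: "geodesic_line V E l \<Longrightarrow> l i = l j \<longleftrightarrow> i = j"
  unfolding geodesic_line_def by (metis dist_self eq_iff_diff_eq_0 nat_0_iff abs_le_zero_iff)

lemma line_segment_walk:
  assumes "geodesic_line V E l"
  shows "nb_walk E n (\<lambda>i. l (b + int i))"
  unfolding nb_walk_def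
proof (intro conjI allI impI)
  fix j
  show "(l (b + int j), l (b + int (Suc j))) \<in> E"
    using assms[unfolded geodesic_line_iff, rule_format, of "b + int j"]
    by (simp add: algebra_simps)
  show "l (b + int j) \<noteq> l (b + int (Suc (Suc j)))"
    using assms[unfolded geodesic_line_iff, rule_format, of "b + int j"]
    by (simp add: algebra_simps)
qed

lemma line_reverse: "geodesic_line V E l \<Longrightarrow> geodesic_line V E (\<lambda>i. l (- i))"
  by (auto simp: geodesic_line_def)

lemma line_shift: "geodesic_line V E l \<Longrightarrow> geodesic_line V E (\<lambda>i. l (i + c))"
  by (auto simp: geodesic_line_def)

definition end_of :: "(nat \<Rightarrow> 'v) \<Rightarrow> (nat \<Rightarrow> 'v) set" where
  "end_of r = ray_equiv V E `` {r}"

definition pos_end :: "(int \<Rightarrow> 'v) \<Rightarrow> (nat \<Rightarrow> 'v) set" where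
  "pos_end l = end_of (\<lambda>n. l (int n))"

definition neg_end :: "(int \<Rightarrow> 'v) \<Rightarrow> (nat \<Rightarrow> 'v) set" where
  "neg_end l = end_of (\<lambda>n. l (- int n))"

lemma equiv_ray_equiv: "equiv (rays V E) (ray_equiv V E)"
proof (rule equivI)
  show "refl_on (rays V E) (ray_equiv V E)"
    unfolding refl_on_def ray_equiv_def by blast
  show "sym (ray_equiv V E)" unfolding sym_def ray_equiv_def by (auto 0 3) metis
  show "trans (ray_equiv V E)"
  proof (rule transI)
    fix r s t assume "(r, s) \<in> ray_equiv V E" "(s, t) \<in> ray_equiv V E"
    then obtain m n m' n' where *: "\<And>k. r (m + k) = s (n + k)" "\<And>k. s (m' + k) = t (n' + k)"
      and R: "r \<in> rays V E" "t \<in> rays V E" unfolding ray_equiv_def by blast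
    have "r ((m + m') + k) = t ((n' + n) + k)" for k
      using *(1)[of "m' + k"] *(2)[of "n + k"] by (simp add: algebra_simps)
    then show "(r, t) \<in> ray_equiv V E" using R unfolding ray_equiv_def by blast
  qed
qed (auto simp: ray_equiv_def)

lemma end_of_in_ends: "r \<in> rays V E \<Longrightarrow> end_of r \<in> ends V E"
  unfolding end_of_def ends_def by (rule quotientI)

lemma endsE:
  assumes "\<eta> \<in> ends V E" obtains r where "r \<in> rays V E" "\<eta> = end_of r"
  using assms unfolding ends_def end_of_def by (rule quotientE)

lemma end_of_eq_iff:
  assumes "r \<in> rays V E" "s \<in> rays V E"
  shows "end_of r = end_of s \<longleftrightarrow> (\<exists>m n. \<forall>k. r (m + k) = s (n + k))"
proof -
  have "end_of r = end_of s \<longleftrightarrow> (r, s) \<in> ray_equiv V E"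
    unfolding end_of_def using equiv_ray_equiv assms by (simp add: eq_equiv_class_iff)
  then show ?thesis using assms unfolding ray_equiv_def by blast
qed

lemma line_pos_ray: "geodesic_line V E l \<Longrightarrow> (\<lambda>n. l (c + int n)) \<in> rays V E"
  by (auto simp: geodesic_line_def rays_def)

lemma line_neg_ray: "geodesic_line V E l \<Longrightarrow> (\<lambda>n. l (c - int n)) \<in> rays V E"
  by (auto simp: geodesic_line_def rays_def)

lemma line_rays:
  assumes "geodesic_line V E l"
  shows "(\<lambda>n. l (int n)) \<in> rays V E" "(\<lambda>n. l (- int n)) \<in> rays V E"
  using line_pos_ray[OF assms, of 0] line_neg_ray[OF assms, of 0] by simp_all

lemma pos_end_in: "geodesic_line V E l \<Longrightarrow> pos_end l \<in> ends V E"
  unfolding pos_end_def by (intro end_of_in_ends line_rays)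

lemma neg_end_in: "geodesic_line V E l \<Longrightarrow> neg_end l \<in> ends V E"
  unfolding neg_end_def by (intro end_of_in_ends line_rays)

text \<open>
  The initial vertex moves along an edge at a time: either the new vertex is put in front of the ray, or
  the ray starts with this edge and loses its first vertex.
\<close>

lemma ray_from_vertex:
  assumes r: "r \<in> rays V E" and "v \<in> V"
  shows "\<exists>s \<in> rays V E. s 0 = v \<and> end_of s = end_of r"
proof -
  have "r 0 \<in> V" using r by (auto simp: rays_def)
  then have "(v, r 0) \<in> E\<^sup>*" using assms tree unfolding is_tree_def by blast
  then show ?thesis
  proof (induction rule: converse_rtrancl_induct)
    case base then show ?case using r by blast
  next
    case (step v w)
    then obtain s where s: "s \<in> rays V E" "s 0 = w" "end_of s = end_of r" by blast
    show ?case
    proof (cases "s 1 = v")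
      case True
      have t: "(\<lambda>i. s (Suc i)) \<in> rays V E" using s by (simp add: rays_iff)
      moreover have "end_of (\<lambda>i. s (Suc i)) = end_of s"
        unfolding end_of_eq_iff[OF t s(1)] by (rule exI[of _ 0], rule exI[of _ 1]) simp
      ultimately show ?thesis using s True by (intro bexI[of _ "\<lambda>i. s (Suc i)"]) auto
    next
      case False
      have t: "case_nat v s \<in> rays V E"
        using s step False unfolding rays_iff by (auto split: nat.split)
      moreover have "end_of (case_nat v s) = end_of s"
        unfolding end_of_eq_iff[OF t s(1)] by (rule exI[of _ 1], rule exI[of _ 0]) simp
      ultimately show ?thesis using s by (intro bexI[of _ "case_nat v s"]) auto
    qed
  qed
qed

text \<open>
  These lines contain a common ray towards \<open>neg_end l\<close> and are parametrised so as to agree on it. Their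
  positive ends run through all ends but \<open>neg_end l\<close>, each once. An automorphism that fixes a ray
  towards \<open>neg_end l\<close> pointwise permutes these lines by composition, and this replaces its action on
  the remaining ends.
\<close>

definition backward_asymptotic :: "(int \<Rightarrow> 'v) \<Rightarrow> (int \<Rightarrow> 'v) \<Rightarrow> bool" where
  "backward_asymptotic l l' \<longleftrightarrow> geodesic_line V E l' \<and> (\<exists>b. \<forall>i\<le>b. l' i = l i)"

text \<open>
  The ray from \<open>l 0\<close> to \<open>\<eta>\<close> runs along \<open>l\<close> backwards up to some vertex \<open>l (- b)\<close> and then leaves it;
  the line follows \<open>l\<close> up to that vertex and then the ray.
\<close>

lemma line_to_end:
  assumes l: "geodesic_line V E l" and \<eta>: "\<eta> \<in> ends V E" "\<eta> \<noteq> neg_end l"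
  shows "\<exists>l'. backward_asymptotic l l' \<and> pos_end l' = \<eta>"
proof -
  obtain r where r: "r \<in> rays V E" "\<eta> = end_of r" using \<eta>(1) by (rule endsE)
  then obtain s where s: "s \<in> rays V E" "s 0 = l 0" "end_of s = \<eta>"
    using ray_from_vertex line_in_V[OF l] by metis
  have "\<exists>b. s b \<noteq> l (- int b)"
  proof (rule ccontr)
    assume "\<nexists>b. s b \<noteq> l (- int b)"
    then have "s = (\<lambda>b. l (- int b))" by auto
    then show False using s \<eta> by (simp add: neg_end_def)
  qed
  then obtain c where c: "s c \<noteq> l (- int c)" "\<And>i. i < c \<Longrightarrow> s i = l (- int i)"
    using exists_least_iff[of "\<lambda>b. s b \<noteq> l (- int b)"] by auto
  then obtain b where b: "c = Suc b" using s by (cases c) auto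
  \<comment> \<open>position \<open>- b\<close> on the line is position \<open>b\<close> on the ray, hence the shift by \<open>2 * b\<close>\<close>
  define l' where "l' j = (if j \<le> - int b then l j else s (nat (j + 2 * int b)))" for j
  have l's: "l' (int t - int b) = s (b + t)" for t
  proof (cases t)
    case 0 then show ?thesis using c b by (simp add: l'_def)
  next
    case (Suc t')
    have "nat (int t - int b + 2 * int b) = b + t" by simp
    then show ?thesis using Suc by (simp add: l'_def)
  qed
  have line: "geodesic_line V E l'"
    unfolding geodesic_line_iff
  proof (intro allI)
    fix i
    consider "i + 2 \<le> - int b" | "i = - int b - 1" | "i \<ge> - int b" by linarith
    then show "(l' i, l' (i + 1)) \<in> E \<and> l' i \<noteq> l' (i + 2)"
    proof cases
      case 1
      then show ?thesis using l by (simp add: l'_def geodesic_line_iff)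
    next
      case 2
      have i: "- int c = i" "i + 2 = int 1 - int b" using 2 b by simp_all
      have "l' i = l (- int c)" "l' (i + 1) = l (- int c + 1)" "l' (i + 2) = s c"
        unfolding i l's using 2 b by (simp_all add: l'_def)
      moreover have "(l (- int c), l (- int c + 1)) \<in> E" using l geodesic_line_iff by blast
      ultimately show ?thesis using c(1) by simp
    next
      case 3
      then obtain t where t: "i = int t - int b"
        by (metis add.commute diff_add_cancel diff_minus_eq_add le_add_diff_inverse2 nonneg_int_cases
            add_uminus_conv_diff diff_ge_0_iff_ge)
      show ?thesis using l's[of t] l's[of "Suc t"] l's[of "Suc (Suc t)"] s(1)
        unfolding t rays_iff by (simp add: algebra_simps)
    qed
  qed
  moreover have "l' (int (0 + k)) = s (2 * b + k)" for k
    using l's[of "b + k"] by (simp add: mult_2 add.assoc)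
  then have "pos_end l' = end_of s"
    unfolding pos_end_def end_of_eq_iff[OF line_rays(1)[OF line] s(1)] by blast
  moreover have "\<forall>i\<le>- int b. l' i = l i" by (simp add: l'_def)
  ultimately show ?thesis using s(3) unfolding backward_asymptotic_def by auto
qed

lemma backward_asymptotic_unique:
  assumes "backward_asymptotic l l1" "backward_asymptotic l l2" "pos_end l1 = pos_end l2"
  shows "l1 = l2"
proof -
  obtain b1 b2 where b1: "\<forall>i\<le>b1. l1 i = l i" and b2: "\<forall>i\<le>b2. l2 i = l i"
    and L: "geodesic_line V E l1" "geodesic_line V E l2"
    using assms unfolding backward_asymptotic_def by blast
  obtain m n where mn: "\<And>k. l1 (int (m + k)) = l2 (int (n + k))"
    using assms(3) end_of_eq_iff[OF line_rays(1)[OF L(1)] line_rays(1)[OF L(2)]]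
    unfolding pos_end_def by blast
  show ?thesis
  proof
    fix i
    define b where "b = min (min b1 b2) (min i 0)"
    define k where "k = nat \<bar>i\<bar>"
    let ?p = "nat (int (m + k) - b)" and ?q = "nat (int (n + k) - b)"
    have kk: "b \<le> int (m + k)" "b \<le> int (n + k)" by (auto simp: b_def)
    have w: "nb_walk E ?p (\<lambda>j. l1 (b + int j))" "nb_walk E ?q (\<lambda>j. l2 (b + int j))"
      using line_segment_walk L by blast+
    have "l1 (b + int ?p) = l1 (int (m + k))" "l2 (b + int ?q) = l2 (int (n + k))"
      using kk by simp_all
    then have "\<forall>j\<le>?p. l1 (b + int j) = l2 (b + int j)"
      using nb_walk_unique[OF w] mn b1 b2 by (simp add: b_def)
    moreover have "nat (i - b) \<le> ?p" "b + int (nat (i - b)) = i" by (auto simp: b_def k_def)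
    ultimately show "l1 i = l2 i" by metis
  qed
qed

lemma backward_asymptotic_pos_end_neq:
  assumes l: "geodesic_line V E l" and "backward_asymptotic l l'"
  shows "pos_end l' \<noteq> neg_end l"
proof
  assume eq: "pos_end l' = neg_end l"
  obtain b where b: "\<forall>i\<le>b. l' i = l i" and L: "geodesic_line V E l'"
    using assms unfolding backward_asymptotic_def by blast
  obtain m n where mn: "\<And>k. l' (int (m + k)) = l (- int (n + k))"
    using eq end_of_eq_iff[OF line_rays(1)[OF L] line_rays(2)[OF l]]
    unfolding pos_end_def neg_end_def by blast
  define k where "k = Suc (nat \<bar>b\<bar>)"
  have "l (- int (n + k)) = l' (- int (n + k))" using b by (simp add: k_def)
  then have "l' (int (m + k)) = l' (- int (n + k))" using mn by metis
  then show False using line_inj[OF L] by (simp add: k_def)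
qed

lemma pos_end_neq_neg_end: "geodesic_line V E l \<Longrightarrow> pos_end l \<noteq> neg_end l"
  using backward_asymptotic_pos_end_neq unfolding backward_asymptotic_def by blast

lemma neg_end_eqD:
  assumes l: "geodesic_line V E l" "geodesic_line V E l'" and eq: "neg_end l' = neg_end l"
  shows "\<exists>c b. \<forall>i\<le>b. l' i = l (i + c)"
proof -
  obtain m n where mn: "\<And>k. l' (- int (m + k)) = l (- int (n + k))"
    using eq end_of_eq_iff[OF line_rays(2)[OF l(2)] line_rays(2)[OF l(1)]]
    unfolding neg_end_def by blast
  have "l' i = l (i + (int m - int n))" if "i \<le> - int m" for i
    using mn[of "nat (- i - int m)"] that by (simp add: algebra_simps)
  then show ?thesis by blast
qed

end


section \<open>Automorphisms and the compact-open topology\<close>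

text \<open>
  Compact subsets of a discrete space are finite, so the compact-open topology is that of pointwise
  convergence on \<open>V\<close>: a neighbourhood of \<open>f\<close> prescribes the values of \<open>f\<close> on a finite set.
\<close>

lemma openin_compact_open_iff:
  "openin (aut_topology V E) T \<longleftrightarrow> T \<subseteq> carrier (aut_group V E) \<and>
     (\<forall>f\<in>T. \<exists>F. finite F \<and> F \<subseteq> V \<and>
        (\<forall>f'\<in>carrier (aut_group V E). (\<forall>v\<in>F. f' v = f v) \<longrightarrow> f' \<in> T))"
  (is "?L \<longleftrightarrow> ?R")
proof
  let ?S = "compact_open_subbase (discrete_topology V)" and ?A = "carrier (aut_group V E)"
  assume ?L
  then obtain T' where T': "openin (topology_generated_by ?S) T'" "T = T' \<inter> ?A"
    unfolding aut_topology_def openin_subtopology by blast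
  from T'(1) have "generate_topology_on ?S T'" by (simp add: openin_topology_generated_by_iff)
  then have "\<forall>f\<in>T' \<inter> ?A. \<exists>F. finite F \<and> F \<subseteq> V \<and>
      (\<forall>f'\<in>?A. (\<forall>v\<in>F. f' v = f v) \<longrightarrow> f' \<in> T')"
  proof induction
    case (Int a b)
    show ?case
    proof
      fix f assume f: "f \<in> a \<inter> b \<inter> ?A"
      then have fa: "f \<in> a \<inter> ?A" and fb: "f \<in> b \<inter> ?A" by auto
      obtain F where "finite F" "F \<subseteq> V" "\<forall>f'\<in>?A. (\<forall>v\<in>F. f' v = f v) \<longrightarrow> f' \<in> a"
        using bspec[OF Int.IH(1) fa] by (elim exE conjE)
      moreover obtain F' where "finite F'" "F' \<subseteq> V" "\<forall>f'\<in>?A. (\<forall>v\<in>F'. f' v = f v) \<longrightarrow> f' \<in> b"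
        using bspec[OF Int.IH(2) fb] by (elim exE conjE)
      ultimately show "\<exists>F. finite F \<and> F \<subseteq> V \<and>
          (\<forall>f'\<in>?A. (\<forall>v\<in>F. f' v = f v) \<longrightarrow> f' \<in> a \<inter> b)"
        by (intro exI[of _ "F \<union> F'"]) auto
    qed
  next
    case (UN K)
    show ?case
    proof
      fix f assume "f \<in> \<Union> K \<inter> ?A"
      then obtain k where k: "k \<in> K" "f \<in> k \<inter> ?A" by blast
      from bspec[OF UN.IH[OF k(1)] k(2)] obtain F where
        "finite F" "F \<subseteq> V" "\<forall>f'\<in>?A. (\<forall>v\<in>F. f' v = f v) \<longrightarrow> f' \<in> k" by (elim exE conjE)
      then show "\<exists>F. finite F \<and> F \<subseteq> V \<and>
          (\<forall>f'\<in>?A. (\<forall>v\<in>F. f' v = f v) \<longrightarrow> f' \<in> \<Union> K)" using k(1) by blast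
    qed
  next
    case (Basis s)
    then obtain K W where K: "s = {f. f ` K \<subseteq> W}" "finite K" "K \<subseteq> V"
      unfolding compact_open_subbase_def by (auto simp: compactin_discrete_topology)
    show ?case
    proof
      fix f assume "f \<in> s \<inter> ?A"
      then show "\<exists>F. finite F \<and> F \<subseteq> V \<and> (\<forall>f'\<in>?A. (\<forall>v\<in>F. f' v = f v) \<longrightarrow> f' \<in> s)"
        using K by (intro exI[of _ K]) auto
    qed
  qed auto
  note basic = this
  show ?R
  proof (intro conjI ballI)
    show "T \<subseteq> ?A" using T'(2) by simp
    fix f assume "f \<in> T"
    then have "f \<in> T' \<inter> ?A" using T'(2) by simp
    from bspec[OF basic this] obtain F where
      F: "finite F" "F \<subseteq> V" "\<forall>f'\<in>?A. (\<forall>v\<in>F. f' v = f v) \<longrightarrow> f' \<in> T'" by (elim exE conjE)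
    then show "\<exists>F. finite F \<and> F \<subseteq> V \<and> (\<forall>f'\<in>?A. (\<forall>v\<in>F. f' v = f v) \<longrightarrow> f' \<in> T)"
      using T'(2) by (intro exI[of _ F]) simp
  qed
next
  let ?S = "compact_open_subbase (discrete_topology V)" and ?A = "carrier (aut_group V E)"
  let ?X = "topology_generated_by ?S"
  assume R: ?R
  have cyl: "openin ?X {g. \<forall>v\<in>F. g v = f v}"
    if "finite F" "F \<subseteq> V" "f \<in> ?A" for F and f :: "'a \<Rightarrow> 'a"
    using that(1,2)
  proof (induction F rule: finite_induct)
    case empty
    have "UNIV = {f :: 'a \<Rightarrow> 'a. f ` {} \<subseteq> {}}" by simp
    then have "UNIV \<in> ?S" unfolding compact_open_subbase_def
      using compactin_empty openin_empty by blast
    then show ?case by (simp add: topology_generated_by_Basis)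
  next
    case (insert x F)
    have "f x \<in> V" using that insert.prems by (simp add: aut_group_def permutes_in_image)
    then have "compactin (discrete_topology V) {x}" "openin (discrete_topology V) {f x}"
      using insert.prems by (simp_all add: compactin_discrete_topology)
    then have "{g. g ` {x} \<subseteq> {f x}} \<in> ?S" unfolding compact_open_subbase_def by blast
    then have "openin ?X {g. g ` {x} \<subseteq> {f x}}" by (rule topology_generated_by_Basis)
    then have "openin ?X ({g. g ` {x} \<subseteq> {f x}} \<inter> {g. \<forall>v\<in>F. g v = f v})"
      using insert by (intro openin_Int) auto
    moreover have "{g. g ` {x} \<subseteq> {f x}} \<inter> {g. \<forall>v\<in>F. g v = f v} = {g. \<forall>v\<in>insert x F. g v = f v}"
      by auto
    ultimately show ?case by simp
  qed
  show ?L
  proof (subst openin_subopen, intro ballI)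
    fix f assume f: "f \<in> T"
    from bspec[OF conjunct2[OF R] f] obtain F
      where F: "finite F" "F \<subseteq> V" "\<forall>f'\<in>?A. (\<forall>v\<in>F. f' v = f v) \<longrightarrow> f' \<in> T"
      by (elim exE conjE)
    have "f \<in> ?A" using f R by blast
    then have "openin (aut_topology V E) ({g. \<forall>v\<in>F. g v = f v} \<inter> ?A)"
      unfolding aut_topology_def openin_subtopology
      by (intro exI[of _ "{g. \<forall>v\<in>F. g v = f v}"] conjI cyl F refl)
    then show "\<exists>T'. openin (aut_topology V E) T' \<and> f \<in> T' \<and> T' \<subseteq> T"
      using F f R by (intro exI[of _ "{g. \<forall>v\<in>F. g v = f v} \<inter> ?A"]) auto
  qed
qed

lemma topspace_aut_topology: "topspace (aut_topology V E) = carrier (aut_group V E)"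
proof
  show "carrier (aut_group V E) \<subseteq> topspace (aut_topology V E)"
    by (rule openin_subset) (auto simp: openin_compact_open_iff)
  show "topspace (aut_topology V E) \<subseteq> carrier (aut_group V E)"
    by (simp add: aut_topology_def topspace_subtopology)
qed

lemma closedin_compact_open_iff:
  "closedin (aut_topology V E) A \<longleftrightarrow> A \<subseteq> carrier (aut_group V E) \<and>
     (\<forall>f\<in>carrier (aut_group V E).
        (\<forall>F. finite F \<longrightarrow> F \<subseteq> V \<longrightarrow> (\<exists>a\<in>A. \<forall>v\<in>F. a v = f v)) \<longrightarrow> f \<in> A)"
proof (cases "A \<subseteq> carrier (aut_group V E)")
  case True
  have avoid: "(\<forall>f\<in>carrier (aut_group V E). P f \<longrightarrow> f \<in> carrier (aut_group V E) - A) \<longleftrightarrow>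
      \<not> (\<exists>a\<in>A. P a)" for P
    using True by blast
  have swap: "(\<forall>f\<in>C - A. \<exists>F. P F \<and> Q F \<and> \<not> R f F) \<longleftrightarrow>
      (\<forall>f\<in>C. (\<forall>F. P F \<longrightarrow> Q F \<longrightarrow> R f F) \<longrightarrow> f \<in> A)"
    for C :: "('a \<Rightarrow> 'a) set" and P Q :: "'a set \<Rightarrow> bool" and R
    by blast
  show ?thesis
    unfolding closedin_def topspace_aut_topology openin_compact_open_iff avoid swap
    using True by blast
qed (simp add: closedin_def topspace_aut_topology)

lemma limitin_compact_open_iff:
  assumes s: "\<And>n. s n \<in> carrier (aut_group V E)" and g: "g \<in> carrier (aut_group V E)"
  shows "limitin (aut_topology V E) s g sequentially \<longleftrightarrow>
     (\<forall>v\<in>V. eventually (\<lambda>n. s n v = g v) sequentially)"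
proof
  let ?A = "carrier (aut_group V E)"
  assume L: "limitin (aut_topology V E) s g sequentially"
  show "\<forall>v\<in>V. eventually (\<lambda>n. s n v = g v) sequentially"
  proof
    fix v assume "v \<in> V"
    then have "openin (aut_topology V E) {f \<in> ?A. f v = g v}"
      unfolding openin_compact_open_iff by (auto intro!: exI[of _ "{v}"])
    then have "eventually (\<lambda>n. s n \<in> {f \<in> ?A. f v = g v}) sequentially"
      using L g unfolding limitin_def by blast
    then show "eventually (\<lambda>n. s n v = g v) sequentially" by (rule eventually_mono) auto
  qed
next
  assume R: "\<forall>v\<in>V. eventually (\<lambda>n. s n v = g v) sequentially"
  show "limitin (aut_topology V E) s g sequentially"
    unfolding limitin_def topspace_aut_topology
  proof (intro conjI allI impI g)
    fix U assume "openin (aut_topology V E) U \<and> g \<in> U"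
    then have "g \<in> U" and U: "\<forall>f\<in>U. \<exists>F. finite F \<and> F \<subseteq> V \<and>
        (\<forall>f'\<in>carrier (aut_group V E). (\<forall>v\<in>F. f' v = f v) \<longrightarrow> f' \<in> U)"
      unfolding openin_compact_open_iff by simp_all
    from bspec[OF U this(1)] obtain F where F: "finite F" "F \<subseteq> V"
      "\<forall>f'\<in>carrier (aut_group V E). (\<forall>v\<in>F. f' v = g v) \<longrightarrow> f' \<in> U"
      by (elim exE conjE)
    have "eventually (\<lambda>n. \<forall>v\<in>F. s n v = g v) sequentially"
      using F R by (simp add: eventually_ball_finite_distrib subset_iff)
    then show "eventually (\<lambda>n. s n \<in> U) sequentially"
      by (rule eventually_mono) (use F s in blast)
  qed
qed

text \<open>Inversion of functions, kept apart from the inversion \<open>inv\<close> of a group structure.\<close>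

abbreviation inv_fun :: "('a \<Rightarrow> 'a) \<Rightarrow> 'a \<Rightarrow> 'a" where
  "inv_fun g \<equiv> inv_into UNIV g"

context locally_finite_tree
begin

abbreviation "Aut \<equiv> carrier (aut_group V E)"

lemma aut_iff:
  "g \<in> Aut \<longleftrightarrow> g permutes V \<and> (\<forall>x\<in>V. \<forall>y\<in>V. (g x, g y) \<in> E \<longleftrightarrow> (x, y) \<in> E)"
  by (simp add: aut_group_def)

lemma mult_aut [simp]: "f \<otimes>\<^bsub>aut_group V E\<^esub> g = f \<circ> g"
  and one_aut [simp]: "\<one>\<^bsub>aut_group V E\<^esub> = id"
  by (simp_all add: aut_group_def)

lemma aut_permutes: "g \<in> Aut \<Longrightarrow> g permutes V" by (simp add: aut_iff)

lemma aut_in_V [simp]: "g \<in> Aut \<Longrightarrow> g v \<in> V \<longleftrightarrow> v \<in> V"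
  by (simp add: aut_permutes permutes_in_image)

lemma aut_eq_iff [simp]: "g \<in> Aut \<Longrightarrow> g x = g y \<longleftrightarrow> x = y"
  by (meson aut_permutes permutes_inj inj_eq)

lemma aut_inv_f [simp]: "g \<in> Aut \<Longrightarrow> inv_fun g (g x) = x"
  by (rule permutes_inverses(2)[OF aut_permutes])

lemma aut_f_inv [simp]: "g \<in> Aut \<Longrightarrow> g (inv_fun g x) = x"
  by (rule permutes_inverses(1)[OF aut_permutes])

lemma aut_eqI: "f \<in> Aut \<Longrightarrow> g \<in> Aut \<Longrightarrow> (\<And>v. v \<in> V \<Longrightarrow> f v = g v) \<Longrightarrow> f = g"
  by (metis aut_permutes ext permutes_not_in)

lemma aut_id [simp]: "id \<in> Aut" by (simp add: aut_iff permutes_id)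

lemma aut_comp [simp]: "f \<in> Aut \<Longrightarrow> g \<in> Aut \<Longrightarrow> f \<circ> g \<in> Aut"
  by (auto simp: aut_iff permutes_compose permutes_in_image)

lemma aut_inv [simp]:
  assumes g: "g \<in> Aut" shows "inv_fun g \<in> Aut"
  unfolding aut_iff
proof (intro conjI ballI)
  show "inv_fun g permutes V" using g by (simp add: aut_permutes permutes_inv)
  fix x y assume xy: "x \<in> V" "y \<in> V"
  have "inv_fun g x \<in> V" "inv_fun g y \<in> V" using \<open>inv_fun g permutes V\<close> xy by (simp_all add: permutes_in_image)
  then have "(g (inv_fun g x), g (inv_fun g y)) \<in> E \<longleftrightarrow> (inv_fun g x, inv_fun g y) \<in> E"
    using g unfolding aut_iff by blast
  then show "(inv_fun g x, inv_fun g y) \<in> E \<longleftrightarrow> (x, y) \<in> E" using g by simp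
qed

lemma aut_inv_inv [simp]: "g \<in> Aut \<Longrightarrow> inv_fun (inv_fun g) = g"
  by (rule inv_inv_eq[OF permutes_bij[OF aut_permutes]])

lemma group_aut: "group (aut_group V E)"
proof (rule groupI)
  fix x assume "x \<in> Aut"
  then show "\<exists>y\<in>Aut. y \<otimes>\<^bsub>aut_group V E\<^esub> x = \<one>\<^bsub>aut_group V E\<^esub>"
    by (intro bexI[of _ "inv_fun x"]) auto
qed (auto simp: comp_assoc)

lemma m_inv_aut [simp]:
  assumes "g \<in> Aut" shows "inv\<^bsub>aut_group V E\<^esub> g = inv_fun g"
  by (rule group.inv_equality[OF group_aut]) (use assms in auto)

lemma pow_aut [simp]: "g [^]\<^bsub>aut_group V E\<^esub> (n::nat) = g ^^ n"
proof (induction n)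
  case 0
  then show ?case by (simp add: aut_group_def nat_pow_def)
next
  case (Suc n)
  have "g [^]\<^bsub>aut_group V E\<^esub> Suc n = g [^]\<^bsub>aut_group V E\<^esub> n \<circ> g"
    by (simp add: nat_pow_def)
  then show ?case by (simp add: Suc funpow_swap1 fun_eq_iff)
qed

lemma aut_funpow [simp]: "g \<in> Aut \<Longrightarrow> g ^^ n \<in> Aut"
  by (induction n) simp_all

lemma aut_edge: "g \<in> Aut \<Longrightarrow> (g x, g y) \<in> E \<longleftrightarrow> (x, y) \<in> E"
  by (metis aut_iff aut_in_V edge_in_V)

lemma aut_relpow: "g \<in> Aut \<Longrightarrow> (x, y) \<in> E ^^ n \<Longrightarrow> (g x, g y) \<in> E ^^ n"
  by (induction n arbitrary: y) (auto simp: aut_edge relpow_Suc_I intro!: relcompI)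

lemma aut_dist [simp]: "g \<in> Aut \<Longrightarrow> d (g x) (g y) = d x y"
proof -
  assume g: "g \<in> Aut"
  have "(g x, g y) \<in> E ^^ n \<longleftrightarrow> (x, y) \<in> E ^^ n" for n
    using aut_relpow[OF g] aut_relpow[OF aut_inv[OF g], of "g x" "g y"] g by auto
  then show ?thesis by (simp add: graph_dist_def)
qed

lemma aut_ray: "g \<in> Aut \<Longrightarrow> g \<circ> r \<in> rays V E \<longleftrightarrow> r \<in> rays V E"
  by (simp add: rays_iff aut_edge)

lemma aut_line: "g \<in> Aut \<Longrightarrow> geodesic_line V E (g \<circ> l) \<longleftrightarrow> geodesic_line V E l"
  by (simp add: geodesic_line_iff aut_edge)

lemma end_act_end_of:
  assumes g: "g \<in> Aut" and r: "r \<in> rays V E"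
  shows "end_act g (end_of r) = end_of (g \<circ> r)"
proof -
  have sub: "(g \<circ> r, g \<circ> s) \<in> ray_equiv V E" if "(r, s) \<in> ray_equiv V E" "g \<in> Aut" for g r s
    using that by (auto simp: ray_equiv_def aut_ray)
  show ?thesis
    unfolding end_act_def end_of_def
  proof (intro equalityI subsetI)
    fix t assume "t \<in> ray_equiv V E `` {g \<circ> r}"
    then have "(inv_fun g \<circ> (g \<circ> r), inv_fun g \<circ> t) \<in> ray_equiv V E" using sub g by auto
    moreover have "inv_fun g \<circ> (g \<circ> r) = r" "t = g \<circ> (inv_fun g \<circ> t)" using g by (auto simp: fun_eq_iff)
    ultimately show "t \<in> (\<lambda>s. g \<circ> s) ` (ray_equiv V E `` {r})" by (metis Image_singleton_iff imageI)
  qed (use sub g in auto)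
qed

lemma end_act_pos_end: "g \<in> Aut \<Longrightarrow> geodesic_line V E l \<Longrightarrow> end_act g (pos_end l) = pos_end (g \<circ> l)"
  and end_act_neg_end: "g \<in> Aut \<Longrightarrow> geodesic_line V E l \<Longrightarrow> end_act g (neg_end l) = neg_end (g \<circ> l)"
  unfolding pos_end_def neg_end_def by (simp_all add: end_act_end_of line_rays comp_def)

lemma end_act_in_ends: "g \<in> Aut \<Longrightarrow> \<eta> \<in> ends V E \<Longrightarrow> end_act g \<eta> \<in> ends V E"
  by (metis endsE end_act_end_of end_of_in_ends aut_ray)

lemma end_act_comp: "end_act (f \<circ> g) \<eta> = end_act f (end_act g \<eta>)"
  unfolding end_act_def by (simp add: image_image comp_assoc)

lemma end_act_id [simp]: "end_act id \<eta> = \<eta>"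
  unfolding end_act_def by simp

lemma end_act_inv:
  assumes "g \<in> Aut" shows "end_act (inv_fun g) \<eta> = \<zeta> \<longleftrightarrow> \<eta> = end_act g \<zeta>"
proof -
  have "inv_fun g \<circ> g = id" "g \<circ> inv_fun g = id" using assms by (auto simp: fun_eq_iff)
  then show ?thesis by (metis end_act_comp end_act_id)
qed

lemma conj_by_eq: "g \<in> Aut \<Longrightarrow> conj_by V E g H = (\<lambda>h. g \<circ> h \<circ> inv_fun g) ` H"
  by (simp add: conj_by_def)

lemma closedin_conj_by:
  assumes g: "g \<in> Aut" and A: "closedin (aut_topology V E) A"
  shows "closedin (aut_topology V E) (conj_by V E g A)"
  unfolding closedin_compact_open_iff conj_by_eq[OF g]
proof (intro conjI ballI impI)
  have AA: "A \<subseteq> Aut" using A by (simp add: closedin_compact_open_iff)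
  then show "(\<lambda>h. g \<circ> h \<circ> inv_fun g) ` A \<subseteq> Aut" using g by auto
  fix f assume f: "f \<in> Aut" and
    H: "\<forall>F. finite F \<longrightarrow> F \<subseteq> V \<longrightarrow> (\<exists>a\<in>(\<lambda>h. g \<circ> h \<circ> inv_fun g) ` A. \<forall>v\<in>F. a v = f v)"
  have "inv_fun g \<circ> f \<circ> g \<in> A"
  proof -
    have "\<exists>a\<in>A. \<forall>v\<in>F. a v = (inv_fun g \<circ> f \<circ> g) v" if F: "finite F" "F \<subseteq> V" for F
    proof -
      have "finite (g ` F)" "g ` F \<subseteq> V" using F g by auto
      then obtain a where "a \<in> A" "\<forall>v\<in>g ` F. (g \<circ> a \<circ> inv_fun g) v = f v" using H by blast
      then show ?thesis using g by (intro bexI[of _ a]) (auto, metis aut_inv_f)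
    qed
    then show ?thesis using A f g unfolding closedin_compact_open_iff by simp
  qed
  moreover have "f = g \<circ> (inv_fun g \<circ> f \<circ> g) \<circ> inv_fun g" using g by (auto simp: fun_eq_iff)
  ultimately show "f \<in> (\<lambda>h. g \<circ> h \<circ> inv_fun g) ` A" by (metis image_eqI)
qed

end


section \<open>Compactness in closed groups of automorphisms\<close>

locale closed_tree_group = locally_finite_tree V E
  for V :: "'v set" and E +
  fixes G :: "('v \<Rightarrow> 'v) set"
  assumes subgroup_G: "subgroup G (aut_group V E)"
    and closed_G: "closedin (aut_topology V E) G"
begin

lemma G_aut [simp]: "g \<in> G \<Longrightarrow> g \<in> Aut"
  using subgroup.subset[OF subgroup_G] by blast

lemma G_id [simp]: "id \<in> G"
  using subgroup.one_closed[OF subgroup_G] by simp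

lemma G_comp [simp]: "f \<in> G \<Longrightarrow> g \<in> G \<Longrightarrow> f \<circ> g \<in> G"
  using subgroup.m_closed[OF subgroup_G] by simp

lemma G_inv [simp]: "g \<in> G \<Longrightarrow> inv_fun g \<in> G"
  using subgroup.m_inv_closed[OF subgroup_G] by (metis G_aut m_inv_aut)

lemma G_funpow [simp]: "g \<in> G \<Longrightarrow> g ^^ n \<in> G"
  by (induction n) simp_all

text \<open>
  Bounded sequences have cluster points. As balls are finite, some infinite subsequence is constant on a
  given ball; repeating this for growing balls yields a limit on all of \<open>V\<close>. The limit is onto since
  preimages of a vertex stay in a bounded region, and it is in \<open>G\<close> as \<open>G\<close> is closed. All later limit
  arguments use this formulation, where "infinitely often" avoids extracting subsequences.
\<close>

lemma cluster_point:
  fixes g :: "nat \<Rightarrow> 'v \<Rightarrow> 'v"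
  assumes g: "\<And>n. g n \<in> G" and N: "infinite N"
    and x: "x \<in> V" and bdd: "finite B" "\<And>n. n \<in> N \<Longrightarrow> g n x \<in> B"
  obtains h where "h \<in> G"
    "\<And>F. finite F \<Longrightarrow> F \<subseteq> V \<Longrightarrow> infinite {n\<in>N. \<forall>v\<in>F. g n v = h v}"
proof -
  define D where "D R = {v \<in> V. d x v \<le> R}" for R
  have finD: "finite (D R)" for R using finite_ball[OF x] by (simp add: D_def)
  have inD: "\<exists>R. F \<subseteq> D R" if "finite F" "F \<subseteq> V" for F
    using that finite_nat_set_iff_bounded_le[of "d x ` F"] unfolding D_def by auto
  define C where "C R = (\<Union>b\<in>B \<inter> V. {v \<in> V. d b v \<le> R})" for R
  have finC: "finite (C R)" for R using bdd(1) finite_ball by (simp add: C_def)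
  have gC: "g n v \<in> C R" if "v \<in> D R" "n \<in> N" for n v R
    using that g bdd(2) x unfolding C_def D_def
    by (intro UN_I[of "g n x"]) auto
  define P where "P R I \<longleftrightarrow> I \<subseteq> N \<and> infinite I \<and> (\<forall>v\<in>D R. \<forall>m\<in>I. \<forall>n\<in>I. g m v = g n v)"
    for R and I :: "nat set"
  have refine: "\<exists>J\<subseteq>I. P R J" if I: "I \<subseteq> N" "infinite I" for I R
  proof -
    let ?r = "\<lambda>n. restrict (g n) (D R)"
    have "?r ` I \<subseteq> (D R \<rightarrow>\<^sub>E C R)" using gC I by auto
    then have "finite (?r ` I)" using finite_PiE[OF finD, of R "\<lambda>_. C R"] finC finite_subset by blast
    from pigeonhole_infinite[OF I(2) this] obtain a where a: "a \<in> I" "infinite {n\<in>I. ?r n = ?r a}"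
      by blast
    have "g n v = g a v" if "?r n = ?r a" "v \<in> D R" for n v
      using fun_cong[OF that(1), of v] that(2) by simp
    note same = this
    define J where "J = {n\<in>I. ?r n = ?r a}"
    have "g n v = g a v" if "v \<in> D R" "n \<in> J" for v n
      by (rule same) (use that in \<open>simp_all add: J_def\<close>)
    then have "g m v = g n v" if "v \<in> D R" "m \<in> J" "n \<in> J" for v m n
      using that by metis
    moreover have J: "J \<subseteq> I" "infinite J" using a(2) unfolding J_def by (fast, simp only: not_False_eq_True)
    ultimately have "P R J" using I(1) unfolding P_def by blast
    then show ?thesis using J(1) by blast
  qed
  have "\<exists>J. \<forall>R. P R (J R) \<and> J (Suc R) \<subseteq> J R"
  proof (rule dependent_nat_choice)
    show "\<exists>I. P 0 I" using refine N by blast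
  next
    fix I R assume "P R I"
    then show "\<exists>J. P (Suc R) J \<and> J \<subseteq> I" using refine[of I "Suc R"] by (auto simp: P_def[of R])
  qed
  then obtain J where J: "\<And>R. P R (J R)" "\<And>R. J (Suc R) \<subseteq> J R" by blast
  have Jmono: "J R \<subseteq> J S" if "S \<le> R" for R S
    using that J(2) by (rule lift_Suc_antimono_le[rotated])
  define m where "m R = (SOME n. n \<in> J R)" for R
  have m: "m R \<in> J R" for R
  proof -
    have "J R \<noteq> {}" using J(1)[of R] unfolding P_def by auto
    then show ?thesis unfolding m_def by (simp add: some_in_eq)
  qed
  define h where "h v = (if v \<in> V then g (m (d x v)) v else v)" for v
  have hJ: "g n v = h v" if "n \<in> J R" "v \<in> D R" for n v R
  proof -
    have "n \<in> J (d x v)" "v \<in> D (d x v)" using that Jmono by (auto simp: D_def)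
    then have "g n v = g (m (d x v)) v" using J(1)[of "d x v"] m[of "d x v"] unfolding P_def by fast
    then show ?thesis using that by (simp add: h_def D_def)
  qed
  have inf: "infinite {n\<in>N. \<forall>v\<in>F. g n v = h v}" if "finite F" "F \<subseteq> V" for F
  proof -
    from inD[OF that] obtain R where R: "F \<subseteq> D R" by (elim exE)
    have "J R \<subseteq> N" using J(1)[of R] by (simp add: P_def)
    then have "J R \<subseteq> {n\<in>N. \<forall>v\<in>F. g n v = h v}" using hJ[of _ R] R by (auto simp: subset_iff)
    moreover have "infinite (J R)" using J(1)[of R] by (simp add: P_def)
    ultimately show ?thesis by (rule infinite_super)
  qed
  have near: "\<exists>n\<in>N. \<forall>v\<in>F. g n v = h v" if "finite F" "F \<subseteq> V" for F
    using infinite_imp_nonempty[OF inf[OF that]] by blast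
  have hV: "h v \<in> V" if v: "v \<in> V" for v
  proof -
    obtain n where "g n v = h v" using near[of "{v}"] v by auto
    then show ?thesis using aut_in_V[OF G_aut[OF g[of n]], of v] v by simp
  qed
  have "h \<in> Aut"
    unfolding aut_iff
  proof (intro conjI ballI)
    have "inj_on h V"
    proof (rule inj_onI)
      fix a b assume "a \<in> V" "b \<in> V" "h a = h b"
      moreover from this obtain n where "g n a = h a" "g n b = h b" using near[of "{a, b}"] by auto
      ultimately show "a = b" using aut_eq_iff[OF G_aut[OF g[of n]], of a b] by simp
    qed
    moreover have "V \<subseteq> h ` V"
    proof
      fix w assume w: "w \<in> V"
      define F where "F = (\<Union>b\<in>B \<inter> V. {v \<in> V. d x v \<le> d b w})"
      have "finite F" "F \<subseteq> V" using bdd(1) finite_ball[OF x] by (auto simp: F_def)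
      then obtain n where n: "n \<in> N" "\<forall>v\<in>F. g n v = h v" using near by blast
      have "d x (inv_fun (g n) w) = d (g n x) (g n (inv_fun (g n) w))"
        by (rule aut_dist[OF G_aut[OF g], symmetric])
      then have "d x (inv_fun (g n) w) = d (g n x) w" using g by simp
      then have "inv_fun (g n) w \<in> F" using bdd(2)[OF n(1)] g w x by (auto simp: F_def)
      then have "inv_fun (g n) w \<in> V" "h (inv_fun (g n) w) = g n (inv_fun (g n) w)"
        using n(2) \<open>F \<subseteq> V\<close> by auto
      moreover from this have "h (inv_fun (g n) w) = w" using g[of n] by simp
      ultimately show "w \<in> h ` V" by (metis image_eqI)
    qed
    ultimately have "bij_betw h V V" using hV by (auto simp: bij_betw_def)
    then show "h permutes V" by (rule bij_imp_permutes) (simp add: h_def)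
    fix a b assume "a \<in> V" "b \<in> V"
    then obtain n where "g n a = h a" "g n b = h b" using near[of "{a, b}"] by auto
    then show "(h a, h b) \<in> E \<longleftrightarrow> (a, b) \<in> E" using aut_edge[OF G_aut[OF g[of n]], of a b] by simp
  qed
  moreover have "\<exists>a\<in>G. \<forall>v\<in>F. a v = h v" if "finite F" "F \<subseteq> V" for F
    using near[OF that] g by blast
  ultimately have "h \<in> G" using closed_G unfolding closedin_compact_open_iff by blast
  then show thesis using inf by (rule that)
qed

end


section \<open>Tubes and the radical of an end\<close>

context locally_finite_tree
begin

definition tube :: "(int \<Rightarrow> 'v) \<Rightarrow> nat \<Rightarrow> int set \<Rightarrow> 'v set" where
  "tube l R I = {v \<in> V. \<exists>j\<in>I. d (l j) v \<le> R}"

lemma tubeI: "v \<in> V \<Longrightarrow> j \<in> I \<Longrightarrow> d (l j) v \<le> R \<Longrightarrow> v \<in> tube l R I"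
  unfolding tube_def by blast

lemma tube_subset_V: "tube l R I \<subseteq> V"
  unfolding tube_def by blast

lemma tube_mono: "R \<le> S \<Longrightarrow> I \<subseteq> J \<Longrightarrow> tube l R I \<subseteq> tube l S J"
  unfolding tube_def by (auto dest: le_trans)

lemma tube_Un: "tube l R (I \<union> J) = tube l R I \<union> tube l R J"
  unfolding tube_def by blast

lemma line_in_tube: "geodesic_line V E l \<Longrightarrow> j \<in> I \<Longrightarrow> l j \<in> tube l R I"
  by (rule tubeI) (auto simp: line_in_V)

lemma finite_tube:
  assumes "geodesic_line V E l" "finite I" shows "finite (tube l R I)"
proof -
  have "tube l R I = (\<Union>j\<in>I. {v \<in> V. d (l j) v \<le> R})" unfolding tube_def by blast
  then show ?thesis using assms finite_ball line_in_V by simp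
qed

lemma tube_translate:
  assumes "a \<in> Aut" "\<And>i. a (l i) = l (i + c)"
  shows "a v \<in> tube l R I \<longleftrightarrow> v \<in> tube l R {i. i + c \<in> I}"
proof -
  have "d (l j) (a v) = d (l (j - c)) v" for j
    using aut_dist[OF assms(1), of "l (j - c)" v] assms(2) by simp
  then have "(\<exists>j\<in>I. d (l j) (a v) \<le> R) \<longleftrightarrow> (\<exists>j\<in>{i. i + c \<in> I}. d (l j) v \<le> R)"
    by (metis (no_types, lifting) diff_add_cancel mem_Collect_eq add_diff_cancel_right')
  then show ?thesis using assms(1) by (simp add: tube_def)
qed

end

context closed_tree_group
begin

text \<open>
  These elements fix balls of every radius, centred at the vertices of a ray towards \<open>\<xi>\<close>. If \<open>\<xi>\<close> is the
  repelling end of a hyperbolic element of \<open>G\<close>, this is its contraction group; but as no hyperbolic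
  element occurs in the definition, it is evident that elements of \<open>G\<close> permute these groups by
  conjugation in the same way as they permute the ends.
\<close>

definition end_radical :: "(nat \<Rightarrow> 'v) set \<Rightarrow> ('v \<Rightarrow> 'v) set" where
  "end_radical \<xi> = {u \<in> G. \<forall>R. \<exists>r\<in>\<xi>. \<forall>j. \<forall>v\<in>V. d (r j) v \<le> R \<longrightarrow> u v = v}"

lemma end_radical_iff_tubes:
  assumes l: "geodesic_line V E l"
  shows "u \<in> end_radical (neg_end l) \<longleftrightarrow> u \<in> G \<and> (\<forall>R. \<exists>J. \<forall>v\<in>tube l R {..J}. u v = v)"
proof -
  have "(\<exists>r\<in>neg_end l. \<forall>j. \<forall>v\<in>V. d (r j) v \<le> R \<longrightarrow> u v = v) \<longleftrightarrow>
      (\<exists>J. \<forall>v\<in>tube l R {..J}. u v = v)" for R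
  proof
    assume "\<exists>r\<in>neg_end l. \<forall>j. \<forall>v\<in>V. d (r j) v \<le> R \<longrightarrow> u v = v"
    then obtain r where r: "r \<in> neg_end l" "\<And>j v. v \<in> V \<Longrightarrow> d (r j) v \<le> R \<Longrightarrow> u v = v" by blast
    obtain m n where mn: "\<And>k. l (- int (m + k)) = r (n + k)"
      using r(1) unfolding neg_end_def end_of_def ray_equiv_def by blast
    have "u v = v" if v: "v \<in> tube l R {..- int m}" for v
    proof -
      obtain j where j: "j \<le> - int m" "d (l j) v \<le> R" using v unfolding tube_def by blast
      have "l j = r (n + nat (- j - int m))" using mn[of "nat (- j - int m)"] j(1) by simp
      then show ?thesis using r(2) j(2) v tube_subset_V by (metis subsetD)
    qed
    then show "\<exists>J. \<forall>v\<in>tube l R {..J}. u v = v" by blast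
  next
    assume "\<exists>J. \<forall>v\<in>tube l R {..J}. u v = v"
    then obtain J where J: "\<And>v. v \<in> tube l R {..J} \<Longrightarrow> u v = v" by blast
    define r where "r n = l (J - int n)" for n
    have "l (- int (nat (- J) + k)) = r (nat J + k)" for k
      by (cases "J \<ge> 0") (simp_all add: r_def)
    moreover have "r \<in> rays V E" unfolding r_def using line_neg_ray[OF l] .
    ultimately have "r \<in> neg_end l" using line_rays[OF l]
      unfolding neg_end_def end_of_def ray_equiv_def by blast
    moreover have "u v = v" if "v \<in> V" "d (r j) v \<le> R" for j v
      using J tubeI[OF that(1), of "J - int j" "{..J}" l R] that(2) by (simp add: r_def)
    ultimately show "\<exists>r\<in>neg_end l. \<forall>j. \<forall>v\<in>V. d (r j) v \<le> R \<longrightarrow> u v = v" by blast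
  qed
  then show ?thesis unfolding end_radical_def by simp
qed

lemma end_radical_subset: "end_radical \<xi> \<subseteq> G"
  unfolding end_radical_def by blast

lemma conj_end_radical:
  assumes g: "g \<in> G"
  shows "conj_by V E g (end_radical \<xi>) = end_radical (end_act g \<xi>)"
proof -
  have sub: "g \<circ> u \<circ> inv_fun g \<in> end_radical (end_act g \<xi>)"
    if g: "g \<in> G" and u: "u \<in> end_radical \<xi>" for g u \<xi>
    unfolding end_radical_def
  proof (intro CollectI conjI allI)
    show "g \<circ> u \<circ> inv_fun g \<in> G" using g u end_radical_subset by (intro G_comp G_inv) auto
    fix R
    obtain r where r: "r \<in> \<xi>" "\<And>j v. v \<in> V \<Longrightarrow> d (r j) v \<le> R \<Longrightarrow> u v = v"
      using u unfolding end_radical_def by blast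
    have "(g \<circ> u \<circ> inv_fun g) v = v" if v: "v \<in> V" "d ((g \<circ> r) j) v \<le> R" for j v
    proof -
      have "d (r j) (inv_fun g v) = d (g (r j)) (g (inv_fun g v))" using g by (simp del: aut_f_inv)
      then have "d (r j) (inv_fun g v) \<le> R" using v g by simp
      then have "u (inv_fun g v) = inv_fun g v" using r(2) v g by simp
      then show ?thesis using g by simp
    qed
    then show "\<exists>r\<in>end_act g \<xi>. \<forall>j. \<forall>v\<in>V. d (r j) v \<le> R \<longrightarrow> (g \<circ> u \<circ> inv_fun g) v = v"
      using r(1) unfolding end_act_def by blast
  qed
  show ?thesis
    unfolding conj_by_eq[OF G_aut[OF g]]
  proof (intro equalityI subsetI)
    fix w assume w: "w \<in> end_radical (end_act g \<xi>)"
    have "end_act (inv_fun g) (end_act g \<xi>) = \<xi>" using g by (simp add: end_act_inv)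
    then have "inv_fun g \<circ> w \<circ> inv_fun (inv_fun g) \<in> end_radical \<xi>"
      using sub[OF G_inv[OF g] w] by simp
    moreover have "w = g \<circ> (inv_fun g \<circ> w \<circ> inv_fun (inv_fun g)) \<circ> inv_fun g"
      using g by (simp add: fun_eq_iff)
    ultimately show "w \<in> (\<lambda>h. g \<circ> h \<circ> inv_fun g) ` end_radical \<xi>" by (metis image_eqI)
  qed (use sub[OF g] in blast)
qed

lemma end_radical_subgroup:
  assumes l: "geodesic_line V E l"
  shows "subgroup (end_radical (neg_end l)) ((aut_group V E)\<lparr>carrier := G\<rparr>)"
proof -
  let ?U = "end_radical (neg_end l)"
  have G: "group ((aut_group V E)\<lparr>carrier := G\<rparr>)"
    using subgroup.subgroup_is_group[OF subgroup_G group_aut] .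
  have comp: "u \<circ> w \<in> ?U" if u: "u \<in> ?U" and w: "w \<in> ?U" for u w
    unfolding end_radical_iff_tubes[OF l]
  proof (intro conjI allI)
    show "u \<circ> w \<in> G" using u w end_radical_subset by (intro G_comp) auto
    fix R
    obtain J J' where J: "\<And>v. v \<in> tube l R {..J} \<Longrightarrow> u v = v" "\<And>v. v \<in> tube l R {..J'} \<Longrightarrow> w v = v"
      using u w unfolding end_radical_iff_tubes[OF l] by metis
    have "tube l R {..min J J'} \<subseteq> tube l R {..J}" "tube l R {..min J J'} \<subseteq> tube l R {..J'}"
      by (rule tube_mono; simp)+
    then have "u v = v" "w v = v" if "v \<in> tube l R {..min J J'}" for v
      using J that by blast+
    then show "\<exists>J. \<forall>v\<in>tube l R {..J}. (u \<circ> w) v = v" by (intro exI[of _ "min J J'"]) simp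
  qed
  have inv: "inv_fun u \<in> ?U" if u: "u \<in> ?U" for u
    unfolding end_radical_iff_tubes[OF l]
  proof (intro conjI allI)
    have uG: "u \<in> G" using u end_radical_subset by auto
    then show "inv_fun u \<in> G" by simp
    fix R
    obtain J where "\<forall>v\<in>tube l R {..J}. u v = v" using u unfolding end_radical_iff_tubes[OF l] by metis
    then have "\<forall>v\<in>tube l R {..J}. inv_fun u v = v" using uG by (metis G_aut aut_inv_f)
    then show "\<exists>J. \<forall>v\<in>tube l R {..J}. inv_fun u v = v" by blast
  qed
  show ?thesis
  proof (rule group.subgroupI[OF G])
    show "?U \<subseteq> carrier ((aut_group V E)\<lparr>carrier := G\<rparr>)" using end_radical_subset by simp
    have "id \<in> ?U" unfolding end_radical_iff_tubes[OF l] by simp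
    then show "?U \<noteq> {}" by blast
    fix a assume a: "a \<in> ?U"
    have "inv\<^bsub>(aut_group V E)\<lparr>carrier := G\<rparr>\<^esub> a = inv_fun a"
      using a end_radical_subset group.m_inv_consistent[OF group_aut subgroup_G, of a] by auto
    then show "inv\<^bsub>(aut_group V E)\<lparr>carrier := G\<rparr>\<^esub> a \<in> ?U" using inv[OF a] by simp
    fix b assume b: "b \<in> ?U"
    then show "a \<otimes>\<^bsub>(aut_group V E)\<lparr>carrier := G\<rparr>\<^esub> b \<in> ?U" using comp[OF a b] by simp
  qed
qed

lemma end_radical_fixes_end:
  assumes l: "geodesic_line V E l" and u: "u \<in> end_radical (neg_end l)"
  shows "backward_asymptotic l (u \<circ> l)" "end_act u (neg_end l) = neg_end l"
proof -
  have uA: "u \<in> Aut" using subsetD[OF end_radical_subset u] by (rule G_aut)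
  have uline: "geodesic_line V E (u \<circ> l)" using uA l by (simp add: aut_line)
  obtain J where "\<forall>v\<in>tube l 0 {..J}. u v = v" using u unfolding end_radical_iff_tubes[OF l] by blast
  then have J: "u (l i) = l i" if "i \<le> J" for i using line_in_tube[OF l] that by auto
  then show "backward_asymptotic l (u \<circ> l)" using uline unfolding backward_asymptotic_def by auto
  have "(u \<circ> l) (- int (nat (- J) + k)) = l (- int (nat (- J) + k))" for k
    using J by simp
  then have "neg_end (u \<circ> l) = neg_end l"
    unfolding neg_end_def end_of_eq_iff[OF line_rays(2)[OF uline] line_rays(2)[OF l]] by blast
  then show "end_act u (neg_end l) = neg_end l" using uA l by (simp add: end_act_neg_end)
qed

end

text \<open>
  From here on \<open>\<alpha>\<close> translates the line \<open>l\<close> in its positive direction, so that \<open>neg_end l\<close> is the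
  repelling end of \<open>\<alpha>\<close>: conjugation by \<open>\<alpha>\<close> carries what happens near \<open>neg_end l\<close> to bounded distance.
\<close>

locale tree_axis = closed_tree_group V E G
  for V :: "'v set" and E and G +
  fixes \<alpha> :: "'v \<Rightarrow> 'v" and l :: "int \<Rightarrow> 'v" and k :: int
  assumes \<alpha>_in_G [simp]: "\<alpha> \<in> G" and line: "geodesic_line V E l"
    and k_pos: "k > 0" and translation: "\<And>i. \<alpha> (l i) = l (i + k)"
begin

abbreviation "T \<equiv> tube l"

lemma l_in_V [simp]: "l i \<in> V" using line line_in_V by blast

lemma finite_T [simp]: "finite I \<Longrightarrow> finite (T R I)" using finite_tube line by blast

lemma \<alpha>_funpow: "(\<alpha> ^^ n) (l i) = l (i + k * int n)"
  by (induction n arbitrary: i) (auto simp: translation algebra_simps)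

lemma inv_translation:
  assumes "a \<in> Aut" "\<And>i. a (l i) = l (i + c)"
  shows "inv_fun a (l i) = l (i - c)"
  using aut_inv_f[OF assms(1), of "l (i - c)"] assms(2)[of "i - c"] by simp

lemma translation_exists: "\<exists>a\<in>G. \<forall>i. a (l i) = l (i + k * t)"
proof (cases "t \<ge> 0")
  case True
  then show ?thesis using \<alpha>_funpow[of "nat t"] by (intro bexI[of _ "\<alpha> ^^ nat t"]) auto
next
  case False
  have "inv_fun (\<alpha> ^^ nat (- t)) (l i) = l (i - k * int (nat (- t)))" for i
    by (rule inv_translation) (simp_all add: \<alpha>_funpow)
  then show ?thesis using False by (intro bexI[of _ "inv_fun (\<alpha> ^^ nat (- t))"]) auto
qed

text \<open>
  \<open>\<alpha>^n g \<alpha>^-n\<close> fixes \<open>v\<close> iff \<open>g\<close> fixes the vertex \<open>\<alpha>^-n v\<close>, which lies close to \<open>l (- k n)\<close>. The tube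
  around \<open>k\<close> consecutive vertices of the axis is finite, and its images under the powers of \<open>\<alpha>\<close> cover
  the tube around the whole axis; so finitely many convergence conditions control an entire half tube.
\<close>

lemma end_radical_iff_contracted:
  assumes g: "g \<in> G"
  shows "g \<in> end_radical (neg_end l) \<longleftrightarrow>
    (\<forall>v\<in>V. eventually (\<lambda>n. (\<alpha> ^^ n \<circ> g \<circ> inv_fun (\<alpha> ^^ n)) v = v) sequentially)"
proof -
  define c where "c n = \<alpha> ^^ n \<circ> g \<circ> inv_fun (\<alpha> ^^ n)" for n
  have c1: "c n v = v \<longleftrightarrow> g (inv_fun (\<alpha> ^^ n) v) = inv_fun (\<alpha> ^^ n) v" for n v
  proof -
    have "c n v = v \<longleftrightarrow> (\<alpha> ^^ n) (g (inv_fun (\<alpha> ^^ n) v)) = (\<alpha> ^^ n) (inv_fun (\<alpha> ^^ n) v)"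
      using aut_f_inv[of "\<alpha> ^^ n" v] by (simp add: c_def)
    then show ?thesis by (simp del: aut_f_inv)
  qed
  have "(\<forall>v\<in>V. eventually (\<lambda>n. c n v = v) sequentially) \<longleftrightarrow>
      (\<forall>R. \<exists>J. \<forall>v\<in>T R {..J}. g v = v)"
  proof
    assume H: "\<forall>v\<in>V. eventually (\<lambda>n. c n v = v) sequentially"
    show "\<forall>R. \<exists>J. \<forall>v\<in>T R {..J}. g v = v"
    proof
      fix R
      have "eventually (\<lambda>n. \<forall>v\<in>T R {0..<k}. c n v = v) sequentially"
        using H subsetD[OF tube_subset_V] by (intro eventually_ball_finite ballI) simp_all
      then obtain N where N: "\<And>n v. n \<ge> N \<Longrightarrow> v \<in> T R {0..<k} \<Longrightarrow> c n v = v"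
        unfolding eventually_sequentially by blast
      have "g v = v" if v: "v \<in> T R {..- (k * int N)}" for v
      proof -
        obtain j where j: "j \<le> - (k * int N)" "d (l j) v \<le> R" using v unfolding tube_def by blast
        \<comment> \<open>the power of \<open>\<alpha>\<close> that moves \<open>l j\<close> into \<open>l ` {0..<k}\<close>\<close>
        define n where "n = nat (- (j div k))"
        have "j div k \<le> - int N"
          using zdiv_mono1[OF j(1) k_pos] k_pos by (simp add: zdiv_zminus1_eq_if)
        then have n: "n \<ge> N" "int n = - (j div k)" unfolding n_def by auto
        have jm: "j + k * int n = j mod k" using n(2) by (simp add: minus_mult_div_eq_mod[symmetric])
        then have "j + k * int n \<in> {0..<k}" using k_pos by simp
        then have "v \<in> T R {i. i + k * int n \<in> {0..<k}}"
          using j v tube_subset_V by (intro tubeI[of v j]) auto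
        then have "(\<alpha> ^^ n) v \<in> T R {0..<k}"
          using tube_translate[of "\<alpha> ^^ n" l "k * int n"] \<alpha>_funpow by simp
        then have "c n ((\<alpha> ^^ n) v) = (\<alpha> ^^ n) v" using N n(1) by blast
        then show ?thesis unfolding c1 by simp
      qed
      then show "\<exists>J. \<forall>v\<in>T R {..J}. g v = v" by blast
    qed
  next
    assume H: "\<forall>R. \<exists>J. \<forall>v\<in>T R {..J}. g v = v"
    show "\<forall>v\<in>V. eventually (\<lambda>n. c n v = v) sequentially"
    proof
      fix v assume v: "v \<in> V"
      obtain J where J: "\<And>w. w \<in> T (d (l 0) v) {..J} \<Longrightarrow> g w = w" using H by blast
      have "c n v = v" if n: "n \<ge> nat (- J)" for n
      proof -
        have "int n \<le> k * int n" using k_pos by (simp add: mult_le_cancel_right1)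
        then have "- (k * int n) \<le> J" using n by linarith
        moreover have "inv_fun (\<alpha> ^^ n) (l i) = l (i + - (k * int n))" for i
          using inv_translation[of "\<alpha> ^^ n" "k * int n"] \<alpha>_funpow by simp
        then have "inv_fun (\<alpha> ^^ n) v \<in> T (d (l 0) v) {..J} \<longleftrightarrow>
            v \<in> T (d (l 0) v) {i. i + - (k * int n) \<in> {..J}}"
          by (intro tube_translate) simp_all
        ultimately have "inv_fun (\<alpha> ^^ n) v \<in> T (d (l 0) v) {..J}"
          using v by (simp add: tubeI[of v 0])
        then show ?thesis unfolding c1 by (rule J)
      qed
      then show "eventually (\<lambda>n. c n v = v) sequentially" unfolding eventually_sequentially by blast
    qed
  qed
  then show ?thesis using g end_radical_iff_tubes[OF line] by (simp add: c_def)
qed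

lemma contraction_group_eq_end_radical:
  "contraction_group V E G \<alpha> = end_radical (neg_end l)"
proof -
  have "g \<in> contraction_group V E G \<alpha> \<longleftrightarrow> g \<in> end_radical (neg_end l)" if g: "g \<in> G" for g
  proof -
    define c where "c n = \<alpha> ^^ n \<circ> g \<circ> inv_fun (\<alpha> ^^ n)" for n
    have cA: "c n \<in> Aut" for n unfolding c_def using g by (intro aut_comp aut_inv) simp_all
    have c_fun: "c = (\<lambda>n. \<alpha> ^^ n \<circ> g \<circ> inv_fun (\<alpha> ^^ n))" by (simp add: c_def fun_eq_iff)
    have "g \<in> contraction_group V E G \<alpha> \<longleftrightarrow> limitin (aut_topology V E) c id sequentially"
      using g unfolding c_fun by (simp add: contraction_group_def Let_def)
    also have "\<dots> \<longleftrightarrow> (\<forall>v\<in>V. eventually (\<lambda>n. c n v = v) sequentially)"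
      unfolding limitin_compact_open_iff[OF cA aut_id] by simp
    finally show ?thesis using end_radical_iff_contracted[OF g] by (simp add: c_def)
  qed
  then show ?thesis using end_radical_subset unfolding contraction_group_def Let_def by blast
qed


section \<open>Decomposing the pointwise stabilisers of half axes\<close>

text \<open>
  As \<open>R\<close> grows, the groups \<open>half_tube_fixer R\<close> decrease, and their intersection is the radical of
  \<open>neg_end l\<close>. Conjugation by positive powers of \<open>\<alpha>\<close> drives an element of \<open>half_tube_fixer R\<close> towards
  the compact group \<open>tube_fixer R\<close>, which \<open>\<alpha>\<close> normalises. The aim of this part is to turn such an
  asymptotic statement into an exact one: an element of \<open>half_tube_fixer 0\<close> is a product of an element
  of the radical and one of \<open>tube_fixer 0\<close>. This is an instance of a theorem of Baumgartner and Willis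
  on contraction groups relative to a compact subgroup.
\<close>

definition tube_fixer :: "nat \<Rightarrow> ('v \<Rightarrow> 'v) set" where
  "tube_fixer R = {m \<in> G. \<forall>v\<in>T R UNIV. m v = v}"

definition half_tube_fixer :: "nat \<Rightarrow> ('v \<Rightarrow> 'v) set" where
  "half_tube_fixer R = {p \<in> G. \<exists>J. \<forall>v\<in>T R {..J}. p v = v}"

lemma tube_fixer_in_G [simp]: "m \<in> tube_fixer R \<Longrightarrow> m \<in> G"
  by (simp add: tube_fixer_def)

lemma half_tube_fixer_in_G [simp]: "p \<in> half_tube_fixer R \<Longrightarrow> p \<in> G"
  by (simp add: half_tube_fixer_def)

lemma tube_fixer_fixes: "m \<in> tube_fixer R \<Longrightarrow> v \<in> T R UNIV \<Longrightarrow> m v = v"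
  by (simp add: tube_fixer_def del: tube_fixer_in_G)

lemma tube_fixer_axis [simp]: "m \<in> tube_fixer R \<Longrightarrow> m (l i) = l i"
  by (rule tube_fixer_fixes[OF _ line_in_tube[OF line UNIV_I]])

lemma tube_fixer_id [simp]: "id \<in> tube_fixer R"
  by (simp add: tube_fixer_def del: tube_fixer_in_G)

lemma tube_fixer_comp [simp]: "f \<in> tube_fixer R \<Longrightarrow> g \<in> tube_fixer R \<Longrightarrow> f \<circ> g \<in> tube_fixer R"
  by (simp add: tube_fixer_def del: tube_fixer_in_G)

lemma tube_fixer_inv [simp]: "f \<in> tube_fixer R \<Longrightarrow> inv_fun f \<in> tube_fixer R"
  unfolding tube_fixer_def
proof (intro CollectI conjI ballI; elim CollectE conjE)
  fix v assume "f \<in> G" "\<forall>v\<in>T R UNIV. f v = v" "v \<in> T R UNIV"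
  then show "inv_fun f v = v" using aut_inv_f[of f v] by simp
qed simp

lemma tube_fixer_antimono: "R \<le> S \<Longrightarrow> tube_fixer S \<subseteq> tube_fixer R"
  using tube_mono[of R S UNIV UNIV l] unfolding tube_fixer_def by auto

lemma tube_fixer_tube:
  assumes "m \<in> tube_fixer R" shows "m v \<in> T S I \<longleftrightarrow> v \<in> T S I"
  using tube_translate[of m l 0 v S I] assms by simp

lemma tube_fixer_conj:
  assumes a: "a \<in> G" "\<And>i. a (l i) = l (i + c)" and m: "m \<in> tube_fixer R"
  shows "a \<circ> m \<circ> inv_fun a \<in> tube_fixer R"
proof -
  have "(a \<circ> m \<circ> inv_fun a) v = v" if "v \<in> T R UNIV" for v
  proof -
    have "inv_fun a v \<in> T R UNIV"
      using tube_translate[of a l c "inv_fun a v" R UNIV] a that by simp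
    then show ?thesis using tube_fixer_fixes[OF m] a(1) by simp
  qed
  moreover have "a \<circ> m \<circ> inv_fun a \<in> G" using a(1) m by (intro G_comp G_inv) simp_all
  ultimately show ?thesis by (simp add: tube_fixer_def del: tube_fixer_in_G)
qed

lemma tube_fixer_conj_inv:
  assumes a: "a \<in> G" "\<And>i. a (l i) = l (i + c)" and m: "m \<in> tube_fixer R"
  shows "inv_fun a \<circ> m \<circ> a \<in> tube_fixer R"
  using tube_fixer_conj[of "inv_fun a" "- c" m R] inv_translation[of a c] a m by simp

text \<open>
  The elements that fix the tube over the window \<open>{- n<..0}\<close> induce on the next block of the tube a set
  of permutations which is finite and decreases as \<open>n\<close> grows, hence is constant from some \<open>m0\<close> on.
  Therefore an element that fixes a window of length \<open>m0\<close> can be replaced by one that fixes a window as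
  long as desired and has the same effect on the next block.
\<close>

lemma window_extension_origin:
  obtains m0 :: nat where "\<And>\<kappa> n::nat. \<kappa> \<in> tube_fixer R \<Longrightarrow> \<forall>v\<in>T S {- int m0<..0}. \<kappa> v = v \<Longrightarrow>
     \<exists>f\<in>tube_fixer R. (\<forall>v\<in>T S {- int n<..0}. f v = v) \<and> (\<forall>v\<in>T S {0<..k}. f v = \<kappa> v)"
proof -
  define W where "W = T S {0<..k}"
  define F where "F n = {\<kappa>\<in>tube_fixer R. \<forall>v\<in>T S {- int n<..0}. \<kappa> v = v}" for n
  define C where "C n = (\<lambda>\<kappa>. restrict \<kappa> W) ` F n" for n
  have F_anti: "F n \<subseteq> F m" if "m \<le> n" for m n
  proof -
    have "T S {- int m<..0} \<subseteq> T S {- int n<..0}" using that by (intro tube_mono) auto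
    then show ?thesis unfolding F_def by auto
  qed
  have finC: "finite (C n)" for n
  proof (rule finite_subset)
    show "C n \<subseteq> (W \<rightarrow>\<^sub>E W)" unfolding C_def F_def W_def using tube_fixer_tube by fastforce
    have "finite W" unfolding W_def by simp
    then show "finite (W \<rightarrow>\<^sub>E W)" by (simp add: finite_PiE)
  qed
  obtain m0 where m0: "\<And>n. card (C m0) \<le> card (C n)"
    using ex_has_least_nat[of "\<lambda>_. True" 0 "\<lambda>n. card (C n)"] by auto
  have "C m0 \<subseteq> C n" for n
  proof (cases "m0 \<le> n")
    case True
    then have "C n \<subseteq> C m0" unfolding C_def using F_anti by blast
    then have "C n = C m0" using m0[of n] finC by (metis card_seteq)
    then show ?thesis by simp
  next
    case False
    then show ?thesis unfolding C_def using F_anti[of n m0] by (intro image_mono) simp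
  qed
  note stable = this
  show thesis
  proof (rule that[of m0])
    fix \<kappa> and n :: nat
    assume "\<kappa> \<in> tube_fixer R" "\<forall>v\<in>T S {- int m0<..0}. \<kappa> v = v"
    then have "restrict \<kappa> W \<in> C m0" unfolding C_def F_def by (intro imageI CollectI conjI)
    then have "restrict \<kappa> W \<in> C n" using stable by (rule subsetD[rotated])
    then obtain f where f: "f \<in> F n" and eq: "restrict \<kappa> W = restrict f W"
      unfolding C_def by (elim imageE)
    have "f v = \<kappa> v" if "v \<in> W" for v using fun_cong[OF eq, of v] that by simp
    then show "\<exists>f\<in>tube_fixer R. (\<forall>v\<in>T S {- int n<..0}. f v = v) \<and> (\<forall>v\<in>T S {0<..k}. f v = \<kappa> v)"
      using f by (intro bexI[of _ f]) (simp_all add: F_def W_def)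
  qed
qed

lemma window_extension:
  obtains m0 :: nat where "\<And>t b \<kappa>. \<kappa> \<in> tube_fixer R \<Longrightarrow>
     \<forall>v\<in>T S {k * t - int m0<..k * t}. \<kappa> v = v \<Longrightarrow>
     \<exists>f\<in>tube_fixer R. (\<forall>v\<in>T S {b<..k * t}. f v = v) \<and>
        (\<forall>v\<in>T S {k * t<..k * t + k}. f v = \<kappa> v)"
proof -
  obtain m0 :: nat where m0: "\<And>\<kappa> n::nat. \<kappa> \<in> tube_fixer R \<Longrightarrow> \<forall>v\<in>T S {- int m0<..0}. \<kappa> v = v \<Longrightarrow>
     \<exists>f\<in>tube_fixer R. (\<forall>v\<in>T S {- int n<..0}. f v = v) \<and> (\<forall>v\<in>T S {0<..k}. f v = \<kappa> v)"
    using that by (rule window_extension_origin[of R S])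
  have "\<exists>f\<in>tube_fixer R. (\<forall>v\<in>T S {b<..k * t}. f v = v) \<and>
        (\<forall>v\<in>T S {k * t<..k * t + k}. f v = \<kappa> v)"
    if \<kappa>: "\<kappa> \<in> tube_fixer R" "\<forall>v\<in>T S {k * t - int m0<..k * t}. \<kappa> v = v" for t b \<kappa>
  proof -
    obtain a where a: "a \<in> G" "\<And>i. a (l i) = l (i + k * t)" using translation_exists by blast
    have aT: "a v \<in> T S I \<longleftrightarrow> v \<in> T S {i. i + k * t \<in> I}" for v I
      using tube_translate[of a l "k * t"] a by simp
    have aT': "inv_fun a v \<in> T S {i. i + k * t \<in> I} \<longleftrightarrow> v \<in> T S I" for v I
      using aT[of "inv_fun a v" I] a(1) by simp
    have sets: "{i. i + k * t \<in> {k * t - int m0<..k * t}} = {- int m0<..0}"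
      "{i. i + k * t \<in> {k * t<..k * t + k}} = {0<..k}"
      "{i. i + k * t \<in> {b<..k * t}} = {b - k * t<..0}" by auto
    define \<kappa>' where "\<kappa>' = inv_fun a \<circ> \<kappa> \<circ> a"
    have \<kappa>'_in: "\<kappa>' \<in> tube_fixer R" unfolding \<kappa>'_def by (rule tube_fixer_conj_inv[OF a \<kappa>(1)])
    have \<kappa>'_fixes: "\<kappa>' v = v" if "v \<in> T S {- int m0<..0}" for v
      using aT[of v "{k * t - int m0<..k * t}"] that \<kappa>(2) a(1) unfolding sets \<kappa>'_def by simp
    then have "\<forall>v\<in>T S {- int m0<..0}. \<kappa>' v = v" by (rule ballI)
    from m0[OF \<kappa>'_in this, of "nat (k * t - b)"] obtain f where f: "f \<in> tube_fixer R"
      "\<forall>v\<in>T S {- int (nat (k * t - b))<..0}. f v = v" "\<forall>v\<in>T S {0<..k}. f v = \<kappa>' v"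
      by (elim bexE conjE)
    have "(a \<circ> f \<circ> inv_fun a) v = v" if v: "v \<in> T S {b<..k * t}" for v
    proof -
      have "inv_fun a v \<in> T S {b - k * t<..0}" using aT'[of v "{b<..k * t}"] v unfolding sets by simp
      moreover have "T S {b - k * t<..0} \<subseteq> T S {- int (nat (k * t - b))<..0}"
        by (rule tube_mono) auto
      ultimately show ?thesis using f(2) a(1) by auto
    qed
    moreover have "(a \<circ> f \<circ> inv_fun a) v = \<kappa> v" if v: "v \<in> T S {k * t<..k * t + k}" for v
    proof -
      have "inv_fun a v \<in> T S {0<..k}" using aT'[of v "{k * t<..k * t + k}"] v unfolding sets by simp
      then show ?thesis using f(3) a(1) by (simp add: \<kappa>'_def)
    qed
    moreover have "a \<circ> f \<circ> inv_fun a \<in> tube_fixer R" by (rule tube_fixer_conj[OF a f(1)])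
    ultimately show ?thesis by (intro bexI[of _ "a \<circ> f \<circ> inv_fun a"] conjI ballI)
  qed
  then show thesis by (rule that)
qed

lemma half_tube_fixerE:
  assumes "p \<in> half_tube_fixer R"
  obtains J where "\<And>v. v \<in> T R {..J} \<Longrightarrow> p v = v"
proof -
  from assms obtain J where "\<forall>v\<in>T R {..J}. p v = v"
    unfolding half_tube_fixer_def by (elim CollectE conjE exE)
  then show thesis by (intro that[of J]) simp
qed

text \<open>
  The conjugates of \<open>p\<close> by the powers of \<open>\<alpha>\<close> fix \<open>l 0\<close> from some point on, and each of their cluster
  points fixes the whole tube. If infinitely many of them differed on \<open>F\<close> from all elements of
  \<open>tube_fixer R\<close>, then so would a cluster point.
\<close>

lemma approximation_near_end:
  assumes p: "p \<in> half_tube_fixer R" and F: "finite F" "F \<subseteq> V"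
  shows "\<exists>N. \<forall>n\<ge>N. \<exists>m\<in>tube_fixer R. \<forall>v\<in>F. m v = (\<alpha> ^^ n \<circ> p \<circ> inv_fun (\<alpha> ^^ n)) v"
proof (rule ccontr)
  define g where "g n = \<alpha> ^^ n \<circ> p \<circ> inv_fun (\<alpha> ^^ n)" for n
  define bad where "bad = {n. \<not> (\<exists>m\<in>tube_fixer R. \<forall>v\<in>F. m v = g n v)}"
  assume "\<not> ?thesis"
  then have bad: "infinite bad" unfolding bad_def g_def infinite_nat_iff_unbounded_le by auto
  have gG: "g n \<in> G" for n unfolding g_def using p by (intro G_comp G_inv) simp_all
  obtain J where J: "\<And>v. v \<in> T R {..J} \<Longrightarrow> p v = v" using half_tube_fixerE[OF p] by metis
  have fixed: "g n v = v" if v: "v \<in> T R {..J + int n}" for n v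
  proof -
    have "int n \<le> k * int n" using k_pos by (simp add: mult_le_cancel_right1)
    then have "T R {..J + int n} \<subseteq> T R {i. i + - (k * int n) \<in> {..J}}" by (intro tube_mono) auto
    moreover have "inv_fun (\<alpha> ^^ n) (l i) = l (i + - (k * int n))" for i
      using inv_translation[of "\<alpha> ^^ n" "k * int n"] \<alpha>_funpow by simp
    then have "inv_fun (\<alpha> ^^ n) v \<in> T R {..J} \<longleftrightarrow> v \<in> T R {i. i + - (k * int n) \<in> {..J}}"
      by (intro tube_translate) simp_all
    ultimately have "inv_fun (\<alpha> ^^ n) v \<in> T R {..J}" using v by blast
    then show ?thesis unfolding g_def using J aut_f_inv[of "\<alpha> ^^ n" v] by simp
  qed
  define N where "N = {n \<in> bad. nat (- J) \<le> n}"
  have "bad \<subseteq> N \<union> {..<nat (- J)}" unfolding N_def by auto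
  then have N: "infinite N" using bad by (meson finite_UnI finite_lessThan finite_subset)
  have bounded: "g n (l 0) \<in> {l 0}" if "n \<in> N" for n
    using that fixed[of "l 0" n] line_in_tube[OF line, of 0 "{..J + int n}" R]
    by (auto simp: N_def)
  obtain h where h: "h \<in> G"
    "\<And>F. finite F \<Longrightarrow> F \<subseteq> V \<Longrightarrow> infinite {n\<in>N. \<forall>v\<in>F. g n v = h v}"
    by (rule cluster_point[of g N "l 0" "{l 0}"]) (use gG N bounded in simp_all)
  have "h v = v" if v: "v \<in> T R UNIV" for v
  proof -
    obtain j where j: "d (l j) v \<le> R" and vV: "v \<in> V" using v unfolding tube_def by blast
    have "infinite {n\<in>N. \<forall>v\<in>{v}. g n v = h v}" using vV by (intro h(2)) auto
    then obtain n where n: "n \<ge> nat (j - J)" "g n v = h v"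
      unfolding infinite_nat_iff_unbounded_le by blast
    have "v \<in> T R {..J + int n}" using n(1) j vV by (intro tubeI[of v j]) auto
    then show ?thesis using fixed n(2) by metis
  qed
  then have "h \<in> tube_fixer R" using h(1) by (simp add: tube_fixer_def del: tube_fixer_in_G)
  moreover obtain n where n: "n \<in> bad" and "\<forall>v\<in>F. g n v = h v"
    using infinite_imp_nonempty[OF h(2)[OF F]] unfolding N_def by auto
  then have "\<forall>v\<in>F. h v = g n v" by simp
  ultimately have "\<exists>m\<in>tube_fixer R. \<forall>v\<in>F. m v = g n v" by (intro bexI[of _ h])
  moreover from n have "\<not> (\<exists>m\<in>tube_fixer R. \<forall>v\<in>F. m v = g n v)" unfolding bad_def by (rule CollectD)
  ultimately show False by (rule notE[rotated])
qed

text \<open>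
  Near \<open>neg_end l\<close>, on each window separately, \<open>p\<close> agrees with some element of \<open>tube_fixer R\<close>. Going
  through the windows in the positive direction, these elements are glued: the quotient of what has
  been glued so far and the next local approximation fixes a window of length \<open>m0\<close>, so it may be
  replaced by an element that does not disturb the agreement obtained before. A cluster point of
  glueings that start closer and closer to the end agrees with \<open>p\<close> on an entire half tube of radius \<open>S\<close>.
\<close>

lemma half_tube_fixer_step:
  assumes p: "p \<in> half_tube_fixer R"
  shows "\<exists>m\<in>tube_fixer R. inv_fun m \<circ> p \<in> half_tube_fixer S"
proof -
  obtain m0 :: nat where m0: "\<And>t b \<kappa>. \<kappa> \<in> tube_fixer R \<Longrightarrow>
      \<forall>v\<in>T S {k * t - int m0<..k * t}. \<kappa> v = v \<Longrightarrow>
      \<exists>f\<in>tube_fixer R. (\<forall>v\<in>T S {b<..k * t}. f v = v) \<and> (\<forall>v\<in>T S {k * t<..k * t + k}. f v = \<kappa> v)"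
    using that by (rule window_extension[of R S])
  obtain N where N: "\<And>n. n \<ge> N \<Longrightarrow> \<exists>m\<in>tube_fixer R. \<forall>v\<in>T S {- int m0<..k}.
      m v = (\<alpha> ^^ n \<circ> p \<circ> inv_fun (\<alpha> ^^ n)) v"
    using approximation_near_end[OF p finite_T tube_subset_V, of "{- int m0<..k}" S] by auto
  have window: "\<exists>m\<in>tube_fixer R. \<forall>v\<in>T S {k * t - int m0<..k * t + k}. m v = p v"
    if t: "t \<le> - int N" for t
  proof -
    define a where "a = \<alpha> ^^ nat (- t)"
    have a: "a \<in> G" "\<And>i. a (l i) = l (i + - (k * t))"
      using t unfolding a_def by (simp_all add: \<alpha>_funpow)
    have "N \<le> nat (- t)" using t by simp
    from N[OF this] obtain m where m: "m \<in> tube_fixer R"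
      "\<forall>v\<in>T S {- int m0<..k}. m v = (a \<circ> p \<circ> inv_fun a) v"
      unfolding a_def by (elim bexE)
    have "(inv_fun a \<circ> m \<circ> a) v = p v" if v: "v \<in> T S {k * t - int m0<..k * t + k}" for v
    proof -
      have "{i. i + - (k * t) \<in> {- int m0<..k}} = {k * t - int m0<..k * t + k}" by auto
      then have "a v \<in> T S {- int m0<..k}"
        using tube_translate[of a l "- (k * t)" v S "{- int m0<..k}"] a v by simp
      then show ?thesis using m(2) a(1) by simp
    qed
    then show ?thesis
      by (intro bexI[of _ "inv_fun a \<circ> m \<circ> a"] ballI tube_fixer_conj_inv[OF a m(1)])
  qed
  have glued: "\<exists>m\<in>tube_fixer R. \<forall>v\<in>T S {k * s - int m0<..k * (s + int n) + k}. m v = p v"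
    if "s + int n \<le> - int N" for s n
    using that
  proof (induction n)
    case 0
    then show ?case using window[of s] by simp
  next
    case (Suc n)
    define t where "t = s + int (Suc n)"
    have kt: "k * (s + int n) + k = k * t" by (simp add: t_def algebra_simps)
    obtain m where m: "m \<in> tube_fixer R" "\<forall>v\<in>T S {k * s - int m0<..k * t}. m v = p v"
      using Suc kt by auto
    obtain m' where m': "m' \<in> tube_fixer R" "\<forall>v\<in>T S {k * t - int m0<..k * t + k}. m' v = p v"
      using window[of t] Suc.prems t_def by auto
    \<comment> \<open>\<open>m\<close> and \<open>m'\<close> both agree with \<open>p\<close> on the overlap of the two windows\<close>
    define \<kappa> where "\<kappa> = inv_fun m \<circ> m'"
    have st: "k * s \<le> k * t" using k_pos by (simp add: t_def)
    have \<kappa>_fixes: "\<kappa> v = v" if v: "v \<in> T S {k * t - int m0<..k * t}" for v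
    proof -
      have sub: "T S {k * t - int m0<..k * t} \<subseteq> T S {k * s - int m0<..k * t}"
        "T S {k * t - int m0<..k * t} \<subseteq> T S {k * t - int m0<..k * t + k}"
        by (rule tube_mono[OF order_refl subsetI], unfold greaterThanAtMost_iff,
            insert st k_pos, linarith)+
      have "m v = p v" "m' v = p v"
        using bspec[OF m(2) subsetD[OF sub(1) v]] bspec[OF m'(2) subsetD[OF sub(2) v]] .
      then have "m' v = m v" by simp
      then show ?thesis using m(1) by (simp add: \<kappa>_def)
    qed
    have "\<kappa> \<in> tube_fixer R" unfolding \<kappa>_def using m m' by simp
    moreover have "\<forall>v\<in>T S {k * t - int m0<..k * t}. \<kappa> v = v" using \<kappa>_fixes by (rule ballI)
    note m0[OF calculation this, of "k * s - int m0"]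
    then obtain f where f: "f \<in> tube_fixer R"
      "\<forall>v\<in>T S {k * s - int m0<..k * t}. f v = v" "\<forall>v\<in>T S {k * t<..k * t + k}. f v = \<kappa> v"
      by (elim bexE conjE)
    have "(m \<circ> f) v = p v" if v: "v \<in> T S {k * s - int m0<..k * t + k}" for v
    proof -
      have "{k * s - int m0<..k * t + k} = {k * s - int m0<..k * t} \<union> {k * t<..k * t + k}"
      proof (rule Set.set_eqI)
        fix x
        show "x \<in> {k * s - int m0<..k * t + k} \<longleftrightarrow>
            x \<in> {k * s - int m0<..k * t} \<union> {k * t<..k * t + k}"
          unfolding Un_iff greaterThanAtMost_iff using st k_pos by linarith
      qed
      then consider "v \<in> T S {k * s - int m0<..k * t}" | "v \<in> T S {k * t<..k * t + k}"
        using v tube_Un by auto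
      then show ?thesis
      proof cases
        case 1 then show ?thesis using f m by simp
      next
        case 2
        moreover have "T S {k * t<..k * t + k} \<subseteq> T S {k * t - int m0<..k * t + k}"
          by (intro tube_mono) auto
        ultimately show ?thesis using f(3) m(1) m'(2) by (auto simp: \<kappa>_def)
      qed
    qed
    moreover have "m \<circ> f \<in> tube_fixer R" using m f by simp
    ultimately show ?case unfolding t_def[symmetric] by (intro bexI[of _ "m \<circ> f"] ballI)
  qed
  define e where "e = k * (- int N) + k"
  have "\<forall>n. \<exists>m\<in>tube_fixer R. \<forall>v\<in>T S {k * (- int N - int n) - int m0<..e}. m v = p v"
    using glued[of "- int N - int n" n for n] unfolding e_def by auto
  then obtain m where m: "\<And>n. m n \<in> tube_fixer R"
    "\<And>n v. v \<in> T S {k * (- int N - int n) - int m0<..e} \<Longrightarrow> m n v = p v" by metis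
  obtain h where h: "h \<in> G"
    "\<And>F. finite F \<Longrightarrow> F \<subseteq> V \<Longrightarrow> infinite {n \<in> UNIV. \<forall>v\<in>F. m n v = h v}"
    by (rule cluster_point[of m UNIV "l 0" "{l 0}"])
      (simp_all add: tube_fixer_in_G[OF m(1)] tube_fixer_axis[OF m(1)])
  have late: "\<exists>n\<ge>n0. m n v = h v" if "v \<in> V" for v n0
    using h(2)[of "{v}"] that unfolding infinite_nat_iff_unbounded_le by auto
  have "h v = v" if "v \<in> T R UNIV" for v
    using late[of v 0] that subsetD[OF tube_subset_V that] tube_fixer_fixes[OF m(1) that] by auto
  then have hK: "h \<in> tube_fixer R" using h(1) by (simp add: tube_fixer_def del: tube_fixer_in_G)
  have "(inv_fun h \<circ> p) v = v" if v: "v \<in> T S {..e}" for v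
  proof -
    obtain j where j: "j \<le> e" "d (l j) v \<le> S" and vV: "v \<in> V" using v unfolding tube_def by blast
    obtain n where n: "n \<ge> Suc (nat (- j))" "m n v = h v" using late[OF vV] by blast
    have "int n \<le> k * int n" "0 \<le> k * int N" using k_pos by (simp_all add: mult_le_cancel_right1)
    moreover have "k * (- int N - int n) = - (k * int N) - k * int n" by (simp add: algebra_simps)
    ultimately have "k * (- int N - int n) - int m0 < j" using n(1) by linarith
    then have "v \<in> T S {k * (- int N - int n) - int m0<..e}" using j vV by (intro tubeI[of v j]) auto
    then have "h v = p v" using m(2) n(2) by metis
    then show ?thesis using aut_inv_f[OF G_aut[OF h(1)], of v] by simp
  qed
  then have "inv_fun h \<circ> p \<in> half_tube_fixer S" using h(1) p unfolding half_tube_fixer_def by auto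
  then show ?thesis using hK by blast
qed


text \<open>
  The step is repeated with radii growing by one, the \<open>n\<close>-th correcting factor being taken from
  \<open>tube_fixer n\<close>. The infinite product of these factors converges, since on a given vertex only
  finitely many of them act, and discarding its tail does not spoil what the first factors achieve.
\<close>

proposition half_tube_fixer_decomposition:
  assumes p: "p \<in> half_tube_fixer 0"
  shows "\<exists>m\<in>tube_fixer 0. p \<circ> inv_fun m \<in> end_radical (neg_end l)"
proof -
  have "\<exists>M. \<forall>n. (M n \<in> tube_fixer 0 \<and> inv_fun (M n) \<circ> p \<in> half_tube_fixer n) \<and>
      (\<exists>m\<in>tube_fixer n. M (Suc n) = M n \<circ> m)"
  proof (rule dependent_nat_choice)
    have "inv_fun id \<circ> p = p" by simp
    then show "\<exists>M. M \<in> tube_fixer 0 \<and> inv_fun M \<circ> p \<in> half_tube_fixer 0"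
      using p tube_fixer_id by metis
  next
    fix M n assume M: "M \<in> tube_fixer 0 \<and> inv_fun M \<circ> p \<in> half_tube_fixer n"
    then obtain m where m: "m \<in> tube_fixer n" "inv_fun m \<circ> (inv_fun M \<circ> p) \<in> half_tube_fixer (Suc n)"
      using half_tube_fixer_step by blast
    have m0: "m \<in> tube_fixer 0" using m(1) tube_fixer_antimono[of 0 n] by auto
    then have Mm: "M \<circ> m \<in> tube_fixer 0" using M by simp
    have "inv_fun (M \<circ> m) = inv_fun m \<circ> inv_fun M"
      using m0 by (intro o_inv_distrib permutes_bij[of _ V] aut_permutes G_aut
          tube_fixer_in_G[OF conjunct1[OF M]]) (rule tube_fixer_in_G)
    then have "inv_fun (M \<circ> m) \<circ> p \<in> half_tube_fixer (Suc n)" using m(2) by (simp add: comp_assoc)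
    then show "\<exists>M'. (M' \<in> tube_fixer 0 \<and> inv_fun M' \<circ> p \<in> half_tube_fixer (Suc n)) \<and>
        (\<exists>m\<in>tube_fixer n. M' = M \<circ> m)" using Mm m(1) by blast
  qed
  then obtain M where M: "\<And>n. M n \<in> tube_fixer 0" "\<And>n. inv_fun (M n) \<circ> p \<in> half_tube_fixer n"
    and step: "\<And>n. \<exists>m\<in>tube_fixer n. M (Suc n) = M n \<circ> m" by metis
  have stable: "M (i + j) v = M i v" if v: "v \<in> T i UNIV" for i j v
  proof (induction j)
    case (Suc j)
    obtain m where m: "m \<in> tube_fixer (i + j)" "M (Suc (i + j)) = M (i + j) \<circ> m" using step by blast
    have "v \<in> T (i + j) UNIV" using v tube_mono[of i "i + j" UNIV UNIV l] by auto
    then have "m v = v" by (rule tube_fixer_fixes[OF m(1)])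
    then show ?case using Suc m(2) by simp
  qed simp
  obtain h where h: "h \<in> G"
    "\<And>F. finite F \<Longrightarrow> F \<subseteq> V \<Longrightarrow> infinite {n \<in> UNIV. \<forall>v\<in>F. M n v = h v}"
    by (rule cluster_point[of M UNIV "l 0" "{l 0}"])
      (simp_all add: tube_fixer_in_G[OF M(1)] tube_fixer_axis[OF M(1)])
  have hM: "h v = M i v" if v: "v \<in> T i UNIV" for i v
  proof -
    have "infinite {n \<in> UNIV. \<forall>v\<in>{v}. M n v = h v}" using v tube_subset_V by (intro h(2)) auto
    then obtain n where "n \<ge> i" "M n v = h v" unfolding infinite_nat_iff_unbounded_le by auto
    then show ?thesis using stable[OF v, of "n - i"] by simp
  qed
  have hK: "h \<in> tube_fixer 0"
    unfolding tube_fixer_def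
  proof (intro CollectI conjI ballI h(1))
    fix v assume "v \<in> T 0 UNIV"
    then show "h v = v" using hM[of v 0] tube_fixer_fixes[OF M(1)[of 0]] by simp
  qed
  have "p \<circ> inv_fun h \<in> end_radical (neg_end l)"
    unfolding end_radical_iff_tubes[OF line]
  proof (intro conjI allI)
    show "p \<circ> inv_fun h \<in> G" using h(1) p by simp
    fix R
    obtain J where J: "\<And>v. v \<in> T R {..J} \<Longrightarrow> (inv_fun (M R) \<circ> p) v = v"
      using half_tube_fixerE[OF M(2)[of R]] by metis
    have "(p \<circ> inv_fun h) w = w" if w: "w \<in> T R {..J}" for w
    proof -
      define v where "v = inv_fun h w"
      have v: "v \<in> T R {..J}" using w tube_fixer_tube[OF tube_fixer_inv[OF hK]] by (simp add: v_def)
      have "M R (inv_fun (M R) (p v)) = M R v" using J[OF v] by simp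
      then have "p v = M R v" using M(1)[of R] by simp
      moreover have "v \<in> T R UNIV" using v tube_mono[of R R "{..J}" UNIV l] by auto
      ultimately have "p v = h v" using hM by simp
      then show ?thesis using h(1) by (simp add: v_def)
    qed
    then show "\<exists>J. \<forall>v\<in>T R {..J}. (p \<circ> inv_fun h) v = v" by blast
  qed
  then show ?thesis using hK by blast
qed


section \<open>Transitivity of the contraction group\<close>

text \<open>
  The rays that some element of \<open>G\<close> makes equivalent to the positive half of the axis, with prescribed
  positions \<open>m\<close> and \<open>n\<close> at which the two rays are matched.
\<close>

definition carried_rays :: "nat \<Rightarrow> nat \<Rightarrow> (nat \<Rightarrow> 'v) set" where
  "carried_rays m n = {r. \<exists>g\<in>G. \<forall>j. g (l (int (m + j))) = r (n + j)}"

text \<open>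
  With \<open>m\<close> and \<open>n\<close> fixed, the group elements that carry approximating rays all send \<open>l (int m)\<close> to
  \<open>r n\<close>, so they have a cluster point.
\<close>

lemma carried_rays_closed:
  assumes near: "\<And>N. \<exists>s\<in>carried_rays m n. \<forall>i\<le>N. s i = r i" and "r 0 \<in> V"
  shows "r \<in> carried_rays m n"
proof -
  have "\<exists>g\<in>G. \<forall>j. n + j \<le> N \<longrightarrow> g (l (int (m + j))) = r (n + j)" for N
  proof -
    obtain s where s: "s \<in> carried_rays m n" "\<forall>i\<le>N. s i = r i" using near[of N] by (elim bexE)
    from s(1) obtain g where "g \<in> G" "\<forall>j. g (l (int (m + j))) = s (n + j)"
      unfolding carried_rays_def by (elim CollectE bexE)
    then show ?thesis using s(2) by (intro bexI[of _ g]) simp_all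
  qed
  then obtain g where g: "\<And>N. g N \<in> G"
    "\<And>N j. n + j \<le> N \<Longrightarrow> g N (l (int (m + j))) = r (n + j)" by metis
  have start: "g N (l (int m)) \<in> {r n}" if "N \<in> {n..}" for N
    using g(2)[of 0 N] that by simp
  obtain h where h: "h \<in> G"
    "\<And>F. finite F \<Longrightarrow> F \<subseteq> V \<Longrightarrow> infinite {N \<in> {n..}. \<forall>v\<in>F. g N v = h v}"
    by (rule cluster_point[of g "{n..}" "l (int m)" "{r n}"]) (use g(1) start infinite_Ici in simp_all)
  have "h (l (int (m + j))) = r (n + j)" for j
  proof -
    let ?F = "{l (int (m + j))}"
    have "infinite {N \<in> {n..}. \<forall>v\<in>?F. g N v = h v}" by (intro h(2)) auto
    then obtain N where "N \<ge> n + j" "g N (l (int (m + j))) = h (l (int (m + j)))"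
      unfolding infinite_nat_iff_unbounded_le by auto
    then show ?thesis using g(2) by simp
  qed
  then show ?thesis unfolding carried_rays_def using h(1) by (intro CollectI bexI[of _ h] allI)
qed

text \<open>
  Baire's argument in the space of rays that start at \<open>l 0\<close>. As \<open>G\<close> is transitive on ends, this space is
  the union of the countably many closed sets \<open>carried_rays m n\<close>. If none of them contained all rays
  with some given initial segment, a sequence of longer and longer initial segments could be chosen, the
  \<open>i\<close>-th one excluding the \<open>i\<close>-th set, and the ray they determine would lie in none of the sets.
\<close>

lemma some_carried_rays_has_interior:
  assumes trans: "transitive_on_set G (ends V E)"
  shows "\<exists>m n N. \<exists>r0\<in>rays V E. r0 0 = l 0 \<and>
    (\<forall>r\<in>rays V E. (\<forall>i\<le>N. r i = r0 i) \<longrightarrow> r \<in> carried_rays m n)"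
proof (rule ccontr)
  assume neg: "\<not> ?thesis"
  define X where "X = {r \<in> rays V E. r 0 = l 0}"
  define D where "D i = case_prod carried_rays (prod_decode i)" for i
  \<comment> \<open>no ray that agrees with the first one up to the given position lies in the \<open>i\<close>-th set\<close>
  define avoids where "avoids i rN \<longleftrightarrow> fst rN \<in> X \<and> i \<le> snd rN \<and>
     (\<forall>s\<in>X. (\<forall>i\<le>snd rN. s i = fst rN i) \<longrightarrow> s \<notin> D i)" for i and rN :: "(nat \<Rightarrow> 'v) \<times> nat"
  have refine: "\<exists>r N'. avoids i (r, N') \<and> (\<forall>j\<le>N. r j = r0 j)" if r0: "r0 \<in> X" for i r0 N
  proof -
    obtain m n where mn: "prod_decode i = (m, n)" by (rule prod.exhaust)
    have "\<not> (\<forall>r\<in>rays V E. (\<forall>j\<le>N. r j = r0 j) \<longrightarrow> r \<in> carried_rays m n)"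
    proof
      assume a: "\<forall>r\<in>rays V E. (\<forall>j\<le>N. r j = r0 j) \<longrightarrow> r \<in> carried_rays m n"
      have b: "r0 \<in> rays V E" "r0 0 = l 0" using r0 by (simp_all add: X_def)
      show False
        by (rule notE[OF neg], rule exI[of _ m], rule exI[of _ n], rule exI[of _ N])
          (rule bexI[of _ r0], rule conjI[OF b(2) a], rule b(1))
    qed
    then have "\<exists>r\<in>rays V E. (\<forall>j\<le>N. r j = r0 j) \<and> r \<notin> carried_rays m n"
      by (simp only: ball_simps(10) not_imp)
    then obtain r where r: "r \<in> rays V E" "\<forall>j\<le>N. r j = r0 j" "r \<notin> carried_rays m n"
      by (elim bexE conjE)
    have rX: "r \<in> X" using r r0 by (simp add: X_def)
    then have "r 0 \<in> V" by (simp add: X_def)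
    have "\<not> (\<forall>N. \<exists>s\<in>carried_rays m n. \<forall>i\<le>N. s i = r i)"
    proof
      assume "\<forall>N. \<exists>s\<in>carried_rays m n. \<forall>i\<le>N. s i = r i"
      then have "r \<in> carried_rays m n"
        by (intro carried_rays_closed \<open>r 0 \<in> V\<close>) (erule spec)
      then show False using r(3) by (rule notE[rotated])
    qed
    then obtain N' where none: "\<not> (\<exists>s\<in>carried_rays m n. \<forall>i\<le>N'. s i = r i)"
      unfolding not_all by (elim exE)
    have N': "\<not> (\<forall>i\<le>N'. s i = r i)" if "s \<in> carried_rays m n" for s
    proof
      assume "\<forall>i\<le>N'. s i = r i"
      then have "\<exists>s\<in>carried_rays m n. \<forall>i\<le>N'. s i = r i" using that by (rule bexI)
      with none show False by (rule notE)
    qed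
    have "avoids i (r, max i N')"
      unfolding avoids_def D_def mn
    proof (intro conjI ballI impI notI)
      fix s assume "\<forall>i'\<le>snd (r, max i N'). s i' = fst (r, max i N') i'"
        "s \<in> (case (m, n) of (m, n) \<Rightarrow> carried_rays m n)"
      then show False using N'[of s] by simp
    qed (use rX in simp_all)
    then show ?thesis using r(2) by blast
  qed
  have "\<exists>f. \<forall>i. avoids i (f i) \<and> (\<forall>j\<le>snd (f i). fst (f (Suc i)) j = fst (f i) j) \<and>
      snd (f i) \<le> snd (f (Suc i))"
  proof (rule dependent_nat_choice)
    have "(\<lambda>n. l (int n)) \<in> X" using line_rays[OF line] by (simp add: X_def)
    from refine[OF this, of 0] show "\<exists>x. avoids 0 x" by blast
  next
    fix rN i assume "avoids i rN"
    then have rX: "fst rN \<in> X" by (simp add: avoids_def)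
    define i' where "i' = Suc i"
    obtain r N' where r: "avoids i' (r, N')" "\<forall>j\<le>snd rN. r j = fst rN j"
      using refine[OF rX] by blast
    have "avoids i' (r, max N' (snd rN))" using r(1) unfolding avoids_def by auto
    then show "\<exists>y. avoids (Suc i) y \<and> (\<forall>j\<le>snd rN. fst y j = fst rN j) \<and> snd rN \<le> snd y"
      using r(2) unfolding i'_def by (intro exI[of _ "(r, max N' (snd rN))"]) simp
  qed
  then obtain f where f: "\<And>i. avoids i (f i)"
    "\<And>i j. j \<le> snd (f i) \<Longrightarrow> fst (f (Suc i)) j = fst (f i) j"
    "\<And>i. snd (f i) \<le> snd (f (Suc i))" by metis
  have agree: "fst (f (i + n)) j = fst (f i) j \<and> snd (f i) \<le> snd (f (i + n))" if "j \<le> snd (f i)" for i j n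
  proof (induction n)
    case (Suc n)
    then show ?case using f(2)[of j "i + n"] f(3)[of "i + n"] that by auto
  qed simp
  have big: "i \<le> snd (f i)" for i using f(1)[of i] by (simp add: avoids_def)
  define s where "s j = fst (f j) j" for j
  have s_eq: "s j = fst (f i) j" if "j \<le> snd (f i)" for i j
  proof (cases "i \<le> j")
    case True then show ?thesis using agree[OF that, of "j - i"] by (simp add: s_def)
  next
    case False then show ?thesis using agree[OF big[of j], of "i - j"] by (simp add: s_def)
  qed
  have "s \<in> rays V E"
    unfolding rays_iff
  proof
    fix i
    have "fst (f (Suc (Suc i))) \<in> rays V E" using f(1) by (simp add: avoids_def X_def)
    moreover have "s i = fst (f (Suc (Suc i))) i" "s (Suc i) = fst (f (Suc (Suc i))) (Suc i)"
      "s (Suc (Suc i)) = fst (f (Suc (Suc i))) (Suc (Suc i))"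
      using big[of "Suc (Suc i)"] by (simp_all add: s_eq)
    ultimately show "(s i, s (Suc i)) \<in> E \<and> s i \<noteq> s (Suc (Suc i))" by (simp add: rays_iff)
  qed
  moreover have "s 0 = l 0" using f(1)[of 0] by (simp add: s_def avoids_def X_def)
  ultimately have sX: "s \<in> X" by (simp add: X_def)
  have "s \<notin> D i" for i using f(1)[of i] sX s_eq unfolding avoids_def by blast
  then have none: "s \<notin> carried_rays m n" for m n
    by (metis D_def prod_encode_inverse case_prod_conv)
  obtain g where g: "g \<in> G" "end_act g (pos_end l) = end_of s"
    using trans pos_end_in[OF line] end_of_in_ends sX unfolding transitive_on_set_def X_def by blast
  have gl: "geodesic_line V E (g \<circ> l)" using g(1) line by (simp add: aut_line)
  have "pos_end (g \<circ> l) = end_of s" using g line by (simp add: end_act_pos_end)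
  then obtain m n where "\<forall>k. (g \<circ> l) (int (m + k)) = s (n + k)"
    using end_of_eq_iff[OF line_rays(1)[OF gl], of s] sX unfolding pos_end_def X_def by blast
  then have "s \<in> carried_rays m n" using g(1) unfolding carried_rays_def by auto
  then show False using none by blast
qed

text \<open>
  The interior found above is moved back to the axis: rays that follow the axis for long enough form a
  neighbourhood that is contained in one orbit.
\<close>

lemma rays_near_axis_in_orbit:
  assumes trans: "transitive_on_set G (ends V E)"
  shows "\<exists>m N. \<forall>r\<in>rays V E. (\<forall>i\<le>N. r i = l (int (m + i))) \<longrightarrow>
    (\<exists>g\<in>G. \<forall>j. g (l (int (m + j))) = r j)"
proof -
  obtain m n N r0 where r0: "r0 \<in> rays V E"
    and int: "\<And>r. r \<in> rays V E \<Longrightarrow> \<forall>i\<le>N. r i = r0 i \<Longrightarrow> r \<in> carried_rays m n"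
    using some_carried_rays_has_interior[OF trans] by metis
  obtain g0 where g0: "g0 \<in> G" "\<And>j. g0 (l (int (m + j))) = r0 (n + j)"
    using int[OF r0] unfolding carried_rays_def by auto
  have "\<exists>g\<in>G. \<forall>j. g (l (int (m + j))) = \<tau> j"
    if \<tau>: "\<tau> \<in> rays V E" "\<And>i. i \<le> N + 2 \<Longrightarrow> \<tau> i = l (int (m + i))" for \<tau>
  proof -
    \<comment> \<open>the image of \<open>\<tau>\<close> prolonged by the beginning of \<open>r0\<close>; two extra steps of agreement with \<open>r0\<close>
      guarantee that the result does not turn back at the junction\<close>
    define r where "r i = (if i < n then r0 i else g0 (\<tau> (i - n)))" for i
    have r_eq: "r i = r0 i" if "i \<le> n + N + 2" for i
    proof (cases "i < n")
      case False
      then show ?thesis using \<tau>(2)[of "i - n"] g0(2)[of "i - n"] that by (simp add: r_def)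
    qed (simp add: r_def)
    have "r \<in> rays V E"
      unfolding rays_iff
    proof
      fix i
      show "(r i, r (Suc i)) \<in> E \<and> r i \<noteq> r (Suc (Suc i))"
      proof (cases "i \<le> n + N")
        case True
        then show ?thesis using r_eq r0 by (simp add: rays_iff)
      next
        case False
        then show ?thesis using \<tau>(1) g0(1) by (simp add: r_def rays_iff aut_edge Suc_diff_le)
      qed
    qed
    then have "r \<in> carried_rays m n" by (rule int) (simp add: r_eq)
    then obtain g where g: "g \<in> G" "\<And>j. g (l (int (m + j))) = r (n + j)"
      unfolding carried_rays_def by auto
    have "(inv_fun g0 \<circ> g) (l (int (m + j))) = \<tau> j" for j
      using g(2)[of j] g0(1) by (simp add: r_def)
    moreover have "inv_fun g0 \<circ> g \<in> G" using g g0 by simp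
    ultimately show ?thesis by blast
  qed
  then show ?thesis by blast
qed

text \<open>
  A large power of \<open>\<alpha>\<close> moves the point where \<open>l'\<close> leaves \<open>l\<close> so far along the axis that the previous
  lemma applies; conjugating back gives elements that map longer and longer parts of \<open>l\<close> to the
  corresponding parts of \<open>l'\<close>, and a cluster point of them does so for the whole line.
\<close>

lemma backward_asymptotic_in_orbit:
  assumes trans: "transitive_on_set G (ends V E)" and l': "backward_asymptotic l l'"
  shows "\<exists>p\<in>half_tube_fixer 0. p \<circ> l = l'"
proof -
  obtain b where b: "\<And>i. i \<le> b \<Longrightarrow> l' i = l i" and line': "geodesic_line V E l'"
    using l' unfolding backward_asymptotic_def by blast
  obtain m N where orbit: "\<And>r. r \<in> rays V E \<Longrightarrow> \<forall>i\<le>N. r i = l (int (m + i)) \<Longrightarrow>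
    \<exists>g\<in>G. \<forall>j. g (l (int (m + j))) = r j"
    using rays_near_axis_in_orbit[OF trans] by metis
  define n0 where "n0 = nat (int m + int N - b)"
  have "\<exists>h\<in>G. \<forall>i\<ge>int m - k * int n. h (l i) = l' i" if n: "n \<ge> n0" for n
  proof -
    define a where "a = \<alpha> ^^ n"
    have a: "a \<in> G" "\<And>i. a (l i) = l (i + k * int n)" unfolding a_def by (simp_all add: \<alpha>_funpow)
    have "int n \<le> k * int n" using k_pos by (simp add: mult_le_cancel_right1)
    then have small: "int m - k * int n + int N \<le> b" using n unfolding n0_def by linarith
    define r where "r i = a (l' (int m - k * int n + int i))" for i
    have "r = a \<circ> (\<lambda>i. l' (int m - k * int n + int i))" by (simp add: r_def fun_eq_iff)
    then have "r \<in> rays V E" using line_pos_ray[OF line'] a(1) by (simp add: aut_ray)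
    moreover have "\<forall>i\<le>N. r i = l (int (m + i))"
      using b small a(2) by (simp add: r_def)
    ultimately obtain g where g: "g \<in> G" "\<And>j. g (l (int (m + j))) = r j" using orbit by blast
    have "(inv_fun a \<circ> g \<circ> a) (l i) = l' i" if i: "i \<ge> int m - k * int n" for i
    proof -
      define j where "j = nat (i - (int m - k * int n))"
      have j: "int m - k * int n + int j = i" "i + k * int n = int (m + j)" using i by (simp_all add: j_def)
      show ?thesis using g(2)[of j] a unfolding r_def j by simp (simp add: j(2))
    qed
    moreover have "inv_fun a \<circ> g \<circ> a \<in> G" using a g by simp
    ultimately show ?thesis by blast
  qed
  then obtain h where h: "\<And>n. n \<ge> n0 \<Longrightarrow> h n \<in> G"
    "\<And>n i. n \<ge> n0 \<Longrightarrow> i \<ge> int m - k * int n \<Longrightarrow> h n (l i) = l' i" by metis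
  define x where "x = int m - k * int n0"
  obtain p where p: "p \<in> G"
    "\<And>F. finite F \<Longrightarrow> F \<subseteq> V \<Longrightarrow> infinite {n \<in> UNIV. \<forall>v\<in>F. h (n0 + n) v = p v}"
  proof (rule cluster_point[of "\<lambda>n. h (n0 + n)" UNIV "l x" "{l' x}"])
    show "h (n0 + n) (l x) \<in> {l' x}" for n
      using h(2)[of "n0 + n" x] k_pos by (simp add: x_def)
  qed (use h(1) in simp_all)
  have pl: "p (l i) = l' i" for i
  proof -
    have "infinite {n \<in> UNIV. \<forall>v\<in>{l i}. h (n0 + n) v = p v}" by (intro p(2)) auto
    then obtain n where n: "n \<ge> nat (int m - i)" "h (n0 + n) (l i) = p (l i)"
      unfolding infinite_nat_iff_unbounded_le by auto
    have "int (n0 + n) \<le> k * int (n0 + n)" using k_pos by (simp add: mult_le_cancel_right1)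
    then have "int m - k * int (n0 + n) \<le> i" using n(1) by linarith
    then show ?thesis using h(2)[of "n0 + n" i] n(2) by simp
  qed
  have "p v = v" if v: "v \<in> T 0 {..b}" for v
  proof -
    obtain j where j: "j \<le> b" "d (l j) v = 0" "v \<in> V" using v unfolding tube_def by auto
    then have "v = l j" using dist_relpow[of "l j" v] by simp
    then show ?thesis using pl b j by simp
  qed
  then have "p \<in> half_tube_fixer 0" using p(1) unfolding half_tube_fixer_def by blast
  then show ?thesis using pl by (intro bexI[of _ p]) auto
qed

text \<open>
  An element that maps \<open>l\<close> to the line with positive end \<open>\<eta>\<close> may be multiplied on the right by an element
  fixing \<open>l\<close> pointwise; by the decomposition, some such product lies in the radical.
\<close>

proposition end_radical_moves_axis:
  assumes trans: "transitive_on_set G (ends V E)" and \<eta>: "\<eta> \<in> ends V E" "\<eta> \<noteq> neg_end l"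
  shows "\<exists>u\<in>end_radical (neg_end l). end_act u (pos_end l) = \<eta>"
proof -
  obtain l' where l': "backward_asymptotic l l'" "pos_end l' = \<eta>"
    using line_to_end[OF line \<eta>] by blast
  obtain p where p: "p \<in> half_tube_fixer 0" "p \<circ> l = l'"
    using backward_asymptotic_in_orbit[OF trans l'(1)] by blast
  obtain m where m: "m \<in> tube_fixer 0" "p \<circ> inv_fun m \<in> end_radical (neg_end l)"
    using half_tube_fixer_decomposition[OF p(1)] by blast
  have "(p \<circ> inv_fun m) \<circ> l = l'" using p(2) tube_fixer_axis[OF tube_fixer_inv[OF m(1)]]
    by (auto simp: fun_eq_iff)
  then have "end_act (p \<circ> inv_fun m) (pos_end l) = \<eta>"
    using l'(2) line p(1) m(1) by (simp add: end_act_pos_end)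
  then show ?thesis using m(2) by blast
qed


section \<open>Freeness of a closed contraction group\<close>

lemma neg_end_translate: "neg_end (\<lambda>i. l (i + c)) = neg_end l"
proof -
  have "\<forall>j. l (- int (nat c + j) + c) = l (- int (nat (- c) + j))"
    by (cases "c \<ge> 0") (auto simp: algebra_simps)
  then show ?thesis
    unfolding neg_end_def end_of_eq_iff[OF line_rays(2)[OF line_shift[OF line]] line_rays(2)[OF line]]
    by (intro exI)
qed

lemma pos_end_translate: "pos_end (\<lambda>i. l (i + c)) = pos_end l"
proof -
  have "\<forall>j. l (int (nat (- c) + j) + c) = l (int (nat c + j))"
    by (cases "c \<ge> 0") (auto simp: algebra_simps)
  then show ?thesis
    unfolding pos_end_def end_of_eq_iff[OF line_rays(1)[OF line_shift[OF line]] line_rays(1)[OF line]]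
    by (intro exI)
qed

lemma translation_fixes_ends:
  assumes "a \<in> Aut" "\<And>i. a (l i) = l (i + c)"
  shows "end_act a (neg_end l) = neg_end l" "end_act a (pos_end l) = pos_end l"
proof -
  have "a \<circ> l = (\<lambda>i. l (i + c))" using assms(2) by auto
  then show "end_act a (neg_end l) = neg_end l" "end_act a (pos_end l) = pos_end l"
    using assms(1) line neg_end_translate pos_end_translate
    by (simp_all add: end_act_neg_end end_act_pos_end)
qed

lemma end_radical_comp:
  "f \<in> end_radical (neg_end l) \<Longrightarrow> g \<in> end_radical (neg_end l) \<Longrightarrow> f \<circ> g \<in> end_radical (neg_end l)"
  using subgroup.m_closed[OF end_radical_subgroup[OF line]] by simp

lemma end_radical_in_G: "f \<in> end_radical \<xi> \<Longrightarrow> f \<in> G"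
  using end_radical_subset by blast

lemma end_radical_inv:
  assumes f: "f \<in> end_radical (neg_end l)" shows "inv_fun f \<in> end_radical (neg_end l)"
proof -
  have "inv\<^bsub>(aut_group V E)\<lparr>carrier := G\<rparr>\<^esub> f = inv_fun f"
    using end_radical_in_G[OF f] group.m_inv_consistent[OF group_aut subgroup_G, of f] by simp
  then show ?thesis using subgroup.m_inv_closed[OF end_radical_subgroup[OF line] f] by simp
qed

text \<open>
  If the radical is closed, this is a compact group that \<open>\<alpha>\<close> normalises and all of whose elements \<open>\<alpha>\<close>
  contracts; such a group is trivial, because on a compact group the contraction is uniform.
\<close>

definition axis_radical :: "('v \<Rightarrow> 'v) set" where
  "axis_radical = end_radical (neg_end l) \<inter> tube_fixer 0"

lemma axis_radical_in_G: "f \<in> axis_radical \<Longrightarrow> f \<in> G"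
  unfolding axis_radical_def by (blast intro: end_radical_in_G)

lemma axis_radical_comp: "f \<in> axis_radical \<Longrightarrow> g \<in> axis_radical \<Longrightarrow> f \<circ> g \<in> axis_radical"
  by (simp add: axis_radical_def end_radical_comp)

lemma axis_radical_inv: "f \<in> axis_radical \<Longrightarrow> inv_fun f \<in> axis_radical"
  by (simp add: axis_radical_def end_radical_inv)

lemma axis_radical_translate:
  assumes a: "a \<in> G" "\<And>i. a (l i) = l (i + c)" and f: "f \<in> axis_radical"
  shows "a \<circ> f \<circ> inv_fun a \<in> axis_radical"
proof -
  have "a \<circ> f \<circ> inv_fun a \<in> conj_by V E a (end_radical (neg_end l))"
    using a f by (simp add: conj_by_eq axis_radical_def)
  then have "a \<circ> f \<circ> inv_fun a \<in> end_radical (neg_end l)"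
    using a by (simp add: conj_end_radical translation_fixes_ends[of a c])
  moreover have "a \<circ> f \<circ> inv_fun a \<in> tube_fixer 0"
    using f by (intro tube_fixer_conj[OF a]) (simp add: axis_radical_def)
  ultimately show ?thesis by (simp add: axis_radical_def)
qed

lemma axis_radical_cluster:
  fixes c :: "nat \<Rightarrow> 'v \<Rightarrow> 'v"
  assumes closed: "closedin (aut_topology V E) (end_radical (neg_end l))"
    and c: "\<And>n. c n \<in> axis_radical"
  obtains h where "h \<in> axis_radical"
    "\<And>F. finite F \<Longrightarrow> F \<subseteq> V \<Longrightarrow> infinite {n. \<forall>v\<in>F. c n v = h v}"
proof -
  have cK: "c n \<in> tube_fixer 0" and cU: "c n \<in> end_radical (neg_end l)" for n
    using c[of n] by (simp_all add: axis_radical_def)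
  obtain h where h: "h \<in> G"
    "\<And>F. finite F \<Longrightarrow> F \<subseteq> V \<Longrightarrow> infinite {n \<in> UNIV. \<forall>v\<in>F. c n v = h v}"
    by (rule cluster_point[of c UNIV "l 0" "{l 0}"])
      (simp_all add: tube_fixer_in_G[OF cK] tube_fixer_axis[OF cK])
  have near: "\<exists>n. \<forall>v\<in>F. c n v = h v" if "finite F" "F \<subseteq> V" for F
    using infinite_imp_nonempty[OF h(2)[OF that]] by auto
  have "\<exists>a\<in>end_radical (neg_end l). \<forall>v\<in>F. a v = h v" if "finite F" "F \<subseteq> V" for F
    using near[OF that] cU by (elim exE) (rule bexI)
  then have "h \<in> end_radical (neg_end l)"
    using closed h(1) unfolding closedin_compact_open_iff by (simp del: ex_simps)
  moreover have "h v = v" if v: "v \<in> T 0 UNIV" for v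
  proof -
    obtain n where "c n v = h v" using near[of "{v}"] subsetD[OF tube_subset_V v] by auto
    then show ?thesis using tube_fixer_fixes[OF cK[of n] v] by simp
  qed
  then have "h \<in> tube_fixer 0" using h(1) unfolding tube_fixer_def by (intro CollectI conjI ballI)
  ultimately have "h \<in> axis_radical" by (simp add: axis_radical_def)
  then show thesis by (rule that) (use h(2) in simp)
qed

text \<open>
  Suppose that the contraction is not uniform. Elements moving vertices closer and closer to the end have
  a cluster point \<open>e\<close>; multiplying them by the inverse of \<open>e\<close> gives elements which moreover fix any
  prescribed finite set. An infinite product of such elements, each factor chosen so as not to affect
  what the partial products do on the vertices used before, moves vertices arbitrarily close to the end. But
  it is an element of the radical.
\<close>

lemma axis_radical_uniformly_contracted:
  assumes closed: "closedin (aut_topology V E) (end_radical (neg_end l))"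
  shows "\<exists>N::nat. \<forall>c\<in>axis_radical. \<forall>v\<in>T r {..- int N}. c v = v"
proof (rule ccontr)
  assume neg: "\<not> ?thesis"
  have moving: "\<exists>c\<in>axis_radical. \<exists>v\<in>T r {..- int N}. c v \<noteq> v" for N :: nat
  proof (rule ccontr)
    assume "\<not> (\<exists>c\<in>axis_radical. \<exists>v\<in>T r {..- int N}. c v \<noteq> v)"
    then have "\<forall>c\<in>axis_radical. \<forall>v\<in>T r {..- int N}. c v = v" by simp
    then have "\<exists>N::nat. \<forall>c\<in>axis_radical. \<forall>v\<in>T r {..- int N}. c v = v" by (rule exI)
    with neg show False by (rule notE)
  qed
  have eventually_fixed: "\<exists>N::nat. \<forall>n\<ge>N. \<forall>v\<in>T r {..- int n}. c v = v" if c: "c \<in> axis_radical" for c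
  proof -
    have "c \<in> end_radical (neg_end l)" using c by (simp add: axis_radical_def)
    then obtain J where J: "\<forall>v\<in>T r {..J}. c v = v"
      unfolding end_radical_iff_tubes[OF line] by (elim conjE) (drule spec[of _ r], elim exE)
    have "T r {..- int n} \<subseteq> T r {..J}" if "n \<ge> nat (- J)" for n
      using that by (intro tube_mono) auto
    then have "\<forall>n\<ge>nat (- J). \<forall>v\<in>T r {..- int n}. c v = v" using J by (simp add: subset_iff)
    then show ?thesis by (rule exI)
  qed
  obtain c where c: "\<And>N::nat. c N \<in> axis_radical" "\<And>N. \<exists>v\<in>T r {..- int N}. c N v \<noteq> v"
    using moving by metis
  obtain e where e: "e \<in> axis_radical"
    "\<And>F. finite F \<Longrightarrow> F \<subseteq> V \<Longrightarrow> infinite {n. \<forall>v\<in>F. c n v = e v}"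
    by (rule axis_radical_cluster[where c = c, OF closed c(1)]) simp_all
  have far: "\<exists>f\<in>axis_radical. (\<forall>v\<in>F. f v = v) \<and> (\<exists>v\<in>T r {..- int N}. f v \<noteq> v)"
    if F: "finite F" "F \<subseteq> V" for F and N :: nat
  proof -
    obtain N' where N': "\<And>n v. n \<ge> N' \<Longrightarrow> v \<in> T r {..- int n} \<Longrightarrow> e v = v"
      using eventually_fixed[OF e(1)] by metis
    have "\<exists>n\<ge>max N N'. n \<in> {n. \<forall>v\<in>F. c n v = e v}"
      using e(2)[OF F] unfolding infinite_nat_iff_unbounded_le by (rule spec)
    then obtain n where n: "n \<ge> max N N'" and "\<forall>v\<in>F. c n v = e v"
      by (elim exE conjE CollectE)
    then have cn: "c n v = e v" if "v \<in> F" for v using that by simp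
    obtain v where v: "v \<in> T r {..- int n}" "c n v \<noteq> v" using c(2) by blast
    have eG: "e \<in> Aut" by (rule G_aut[OF axis_radical_in_G[OF e(1)]])
    have "e v = v" using N'[of n v] v(1) n by simp
    then have "(inv_fun e \<circ> c n) v \<noteq> v" using v(2) aut_f_inv[OF eG, of "c n v"] by auto
    moreover have "v \<in> T r {..- int N}"
      using v(1) n tube_mono[of r r "{..- int n}" "{..- int N}" l] by auto
    moreover have "(inv_fun e \<circ> c n) w = w" if "w \<in> F" for w
      using cn[OF that] eG by simp
    moreover have "inv_fun e \<circ> c n \<in> axis_radical" using e(1) c(1) axis_radical_comp axis_radical_inv by simp
    ultimately show ?thesis by (intro bexI[of _ "inv_fun e \<circ> c n"] conjI ballI bexI[of _ v])
  qed
  \<comment> \<open>a partial product, with a finite set that all later factors fix and that contains a moved vertex\<close>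
  define good where "good i DF \<longleftrightarrow> fst DF \<in> axis_radical \<and> finite (snd DF) \<and> snd DF \<subseteq> V \<and>
      (\<exists>v\<in>snd DF \<inter> T r {..- int i}. fst DF v \<noteq> v)" for i :: nat and DF :: "('v \<Rightarrow> 'v) \<times> 'v set"
  have next_good: "\<exists>D' F'. good i (D', F') \<and> F \<subseteq> F' \<and> (\<forall>v\<in>F. D' v = D v)"
    if D: "D \<in> axis_radical" and F: "finite F" "F \<subseteq> V" for i D F
  proof -
    obtain N' where N': "\<And>n v. n \<ge> N' \<Longrightarrow> v \<in> T r {..- int n} \<Longrightarrow> D v = v"
      using eventually_fixed[OF D] by metis
    obtain f v where f: "f \<in> axis_radical" "\<And>w. w \<in> F \<Longrightarrow> f w = w"
      and v: "v \<in> T r {..- int (max i N')}" "f v \<noteq> v"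
    proof -
      from far[OF F, of "max i N'"] obtain f v where "f \<in> axis_radical" "\<forall>w\<in>F. f w = w"
        "v \<in> T r {..- int (max i N')}" "f v \<noteq> v" by (elim bexE conjE)
      then show thesis using that[of f v] by simp
    qed
    have "f \<in> tube_fixer 0" using f(1) by (simp add: axis_radical_def)
    then have "f v \<in> T r {..- int (max i N')}" using v(1) tube_fixer_tube by blast
    then have "D (f v) = f v" using N'[of "max i N'"] by simp
    moreover have "v \<in> T r {..- int i}"
      using v(1) tube_mono[of r r "{..- int (max i N')}" "{..- int i}" l] by auto
    moreover have "v \<in> V" using v(1) tube_subset_V by blast
    ultimately have "good i (D \<circ> f, insert v F)"
      unfolding good_def using D f(1) F v(2) axis_radical_comp by simp
    moreover have "(D \<circ> f) w = D w" if "w \<in> F" for w using f(2)[OF that] by simp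
    ultimately show ?thesis
      by (intro exI[of _ "D \<circ> f"] exI[of _ "insert v F"] conjI ballI subset_insertI)
  qed
  have "\<exists>DF. \<forall>i. good i (DF i) \<and> snd (DF i) \<subseteq> snd (DF (Suc i)) \<and>
      (\<forall>v\<in>snd (DF i). fst (DF (Suc i)) v = fst (DF i) v)"
  proof (rule dependent_nat_choice)
    have "id \<in> axis_radical" using subgroup.one_closed[OF end_radical_subgroup[OF line]]
      by (simp add: axis_radical_def)
    then show "\<exists>x. good 0 x" using next_good[of id "{}" 0] by blast
  next
    fix DF i assume "good i DF"
    then have "fst DF \<in> axis_radical" "finite (snd DF)" "snd DF \<subseteq> V" by (simp_all add: good_def)
    from next_good[OF this, of "Suc i"] obtain D' F' where
      "good (Suc i) (D', F')" "snd DF \<subseteq> F'" "\<forall>v\<in>snd DF. D' v = fst DF v" by (elim exE conjE)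
    then show "\<exists>y. good (Suc i) y \<and> snd DF \<subseteq> snd y \<and> (\<forall>v\<in>snd DF. fst y v = fst DF v)"
      by (intro exI[of _ "(D', F')"]) simp
  qed
  then obtain DF where DF: "\<And>i. good i (DF i)" "\<And>i. snd (DF i) \<subseteq> snd (DF (Suc i))"
    "\<And>i v. v \<in> snd (DF i) \<Longrightarrow> fst (DF (Suc i)) v = fst (DF i) v" by metis
  have stable: "v \<in> snd (DF (i + j)) \<and> fst (DF (i + j)) v = fst (DF i) v" if "v \<in> snd (DF i)" for i j v
  proof (induction j)
    case (Suc j)
    then show ?case using DF(2)[of "i + j"] DF(3)[of v "i + j"] by auto
  qed (use that in simp)
  have "fst (DF i) \<in> axis_radical" for i using DF(1)[of i] by (simp add: good_def)
  note DF_in = this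
  obtain h where h: "h \<in> axis_radical"
    "\<And>F. finite F \<Longrightarrow> F \<subseteq> V \<Longrightarrow> infinite {n. \<forall>v\<in>F. fst (DF n) v = h v}"
    by (rule axis_radical_cluster[where c = "\<lambda>i. fst (DF i)", OF closed DF_in]) simp_all
  obtain N where N: "\<And>n v. n \<ge> N \<Longrightarrow> v \<in> T r {..- int n} \<Longrightarrow> h v = v"
    using eventually_fixed[OF h(1)] by metis
  obtain v where v: "v \<in> snd (DF N)" "v \<in> T r {..- int N}" "fst (DF N) v \<noteq> v"
    using DF(1)[of N] unfolding good_def by blast
  have "infinite {n. \<forall>w\<in>{v}. fst (DF n) w = h w}" using v(2) tube_subset_V by (intro h(2)) auto
  then obtain n where "n \<ge> N" "fst (DF n) v = h v" unfolding infinite_nat_iff_unbounded_le by auto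
  then have "h v = fst (DF N) v" using stable[OF v(1), of "n - N"] by simp
  then show False using N[of N v] v by simp
qed

text \<open>By translation invariance, the half tube that all elements fix can be shifted over any given vertex.\<close>

lemma axis_radical_trivial:
  assumes closed: "closedin (aut_topology V E) (end_radical (neg_end l))" and c: "c \<in> axis_radical"
  shows "c = id"
proof (rule aut_eqI)
  show cA: "c \<in> Aut" by (rule G_aut[OF axis_radical_in_G[OF c]])
  fix v assume v: "v \<in> V"
  define r where "r = d (l 0) v"
  obtain N :: nat where N: "\<And>c v. c \<in> axis_radical \<Longrightarrow> v \<in> T r {..- int N} \<Longrightarrow> c v = v"
    using axis_radical_uniformly_contracted[OF closed, of r] by metis
  obtain a where a: "a \<in> G" "\<And>i. a (l i) = l (i + k * (- int N))" using translation_exists by blast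
  have "int N \<le> k * int N" using k_pos by (simp add: mult_le_cancel_right1)
  then have "a v \<in> T r {..- int N}"
    using tube_translate[of a l "k * (- int N)" v r "{..- int N}"] a v
    by (simp add: tubeI[of v 0] r_def)
  then have "(a \<circ> c \<circ> inv_fun a) (a v) = a v" using axis_radical_translate[OF a c] by (rule N[rotated])
  then show "c v = id v" using a(1) by simp
qed simp

text \<open>
  By transitivity the fixed end may be taken to be \<open>pos_end l\<close>. An element of the radical that fixes it
  maps \<open>l\<close> to a line with the same ends and the same parametrisation near \<open>neg_end l\<close>, so fixes \<open>l\<close>
  pointwise.
\<close>

proposition end_radical_free:
  assumes trans: "transitive_on_set G (ends V E)"
    and closed: "closedin (aut_topology V E) (end_radical (neg_end l))"
    and u: "u \<in> end_radical (neg_end l)"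
    and \<eta>: "\<eta> \<in> ends V E" "\<eta> \<noteq> neg_end l" "end_act u \<eta> = \<eta>"
  shows "u = id"
proof -
  obtain w where w: "w \<in> end_radical (neg_end l)" "end_act w (pos_end l) = \<eta>"
    using end_radical_moves_axis[OF trans \<eta>(1,2)] by blast
  have wA: "w \<in> Aut" by (rule G_aut[OF end_radical_in_G[OF w(1)]])
  define f where "f = inv_fun w \<circ> u \<circ> w"
  have fU: "f \<in> end_radical (neg_end l)"
    unfolding f_def by (intro end_radical_comp end_radical_inv u w(1))
  have fG: "f \<in> G" by (rule end_radical_in_G[OF fU])
  then have fA: "f \<in> Aut" by simp
  have "end_act f (pos_end l) = pos_end l"
    unfolding f_def end_act_comp w(2) \<eta>(3) using wA w(2) by (simp add: end_act_inv)
  then have "f \<circ> l = l"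
    using fA line backward_asymptotic_unique[of l "f \<circ> l" l] end_radical_fixes_end(1)[OF line fU]
    by (auto simp: end_act_pos_end backward_asymptotic_def)
  then have fl: "f (l i) = l i" for i by (simp add: fun_eq_iff)
  have "f v = v" if v: "v \<in> T 0 UNIV" for v
  proof -
    obtain j where "d (l j) v = 0" "v \<in> V" using v unfolding tube_def by auto
    then have "v = l j" using dist_relpow[of "l j" v] by simp
    then show ?thesis using fl by simp
  qed
  then have "f \<in> tube_fixer 0"
    unfolding tube_fixer_def using fG by (intro CollectI conjI ballI)
  then have "f = id" using axis_radical_trivial[OF closed] fU by (simp add: axis_radical_def)
  then have "w (f (inv_fun w v)) = v" for v using wA by simp
  then show ?thesis using wA by (simp add: f_def fun_eq_iff)
qed


section \<open>Uniqueness of the root groups\<close>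

text \<open>
  For \<open>w\<close> in \<open>W\<close> the conjugates of \<open>w\<close> by the powers of \<open>\<alpha>\<close> are in \<open>W\<close> and form a bounded sequence. On
  longer and longer parts of the axis they act as one and the same translation, so that every
  cluster point fixes \<open>pos_end l\<close> and hence is trivial by freeness of \<open>W\<close>. Thus \<open>\<alpha>\<close> contracts \<open>w\<close>. The
  resulting inclusion is an equality, as \<open>W\<close> is transitive and the larger group is free.
\<close>

lemma root_group_eq_end_radical:
  assumes trans: "transitive_on_set G (ends V E)"
    and closed: "closedin (aut_topology V E) (end_radical (neg_end l))"
    and W: "W \<subseteq> G" "closedin (aut_topology V E) W"
    and W_conj: "\<And>w. w \<in> W \<Longrightarrow> \<alpha> \<circ> w \<circ> inv_fun \<alpha> \<in> W"
    and W_fix: "\<And>w. w \<in> W \<Longrightarrow> end_act w (neg_end l) = neg_end l"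
    and W_trans: "transitive_on_set W (ends V E - {neg_end l})"
    and W_free: "free_on_set W (ends V E - {neg_end l})"
  shows "W = end_radical (neg_end l)"
proof -
  have pos: "pos_end l \<in> ends V E - {neg_end l}"
    using pos_end_in[OF line] pos_end_neq_neg_end[OF line] by simp
  have sub: "w \<in> end_radical (neg_end l)" if w: "w \<in> W" for w
  proof (rule ccontr)
    define c where "c n = \<alpha> ^^ n \<circ> w \<circ> inv_fun (\<alpha> ^^ n)" for n
    have wG: "w \<in> G" using w W(1) by blast
    have cW: "c n \<in> W" for n
    proof (induction n)
      case 0
      then show ?case using w by (simp add: c_def)
    next
      case (Suc n)
      have "inv_fun (\<alpha> ^^ Suc n) = inv_fun (\<alpha> ^^ n) \<circ> inv_fun \<alpha>"
        unfolding funpow.simps by (intro o_inv_distrib permutes_bij[of _ V] aut_permutes) simp_all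
      then have "c (Suc n) = \<alpha> \<circ> c n \<circ> inv_fun \<alpha>" by (simp add: c_def comp_assoc)
      then show ?case using W_conj[OF Suc.IH] by (simp only:)
    qed
    assume "w \<notin> end_radical (neg_end l)"
    then obtain v where v: "v \<in> V" "\<not> eventually (\<lambda>n. c n v = v) sequentially"
      using end_radical_iff_contracted[OF wG] unfolding c_def by blast
    define N where "N = {n. c n v \<noteq> v}"
    have N: "infinite N"
      using v(2) unfolding N_def eventually_sequentially infinite_nat_iff_unbounded_le by auto
    have wl: "geodesic_line V E (w \<circ> l)" using wG line by (simp add: aut_line)
    have "neg_end (w \<circ> l) = neg_end l" using W_fix[OF w] wG line by (simp add: end_act_neg_end)
    then obtain s b where "\<forall>i\<le>b. (w \<circ> l) i = l (i + s)" using neg_end_eqD[OF line wl] by blast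
    then have sb: "w (l i) = l (i + s)" if "i \<le> b" for i using that by simp
    have cl: "c n (l i) = l (i + s)" if "i \<le> b + int n" for i n
    proof -
      have "int n \<le> k * int n" using k_pos by (simp add: mult_le_cancel_right1)
      then have "i - k * int n \<le> b" using that by linarith
      moreover have "inv_fun (\<alpha> ^^ n) (l i) = l (i - k * int n)"
        by (rule inv_translation) (simp_all add: \<alpha>_funpow)
      ultimately show ?thesis by (simp add: c_def sb \<alpha>_funpow)
    qed
    define N' where "N' = {n \<in> N. nat (- b) \<le> n}"
    have "N \<subseteq> N' \<union> {..<nat (- b)}" unfolding N'_def by auto
    then have N': "infinite N'" using N by (meson finite_UnI finite_lessThan finite_subset)
    have bounded: "c n (l 0) \<in> {l s}" if "n \<in> N'" for n
    proof -
      have "nat (- b) \<le> n" using that by (simp add: N'_def)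
      then have "0 \<le> b + int n" by linarith
      then show ?thesis using cl[of 0 n] by simp
    qed
    have cG: "c n \<in> G" for n using cW W(1) by blast
    obtain h where h: "h \<in> G"
      "\<And>F. finite F \<Longrightarrow> F \<subseteq> V \<Longrightarrow> infinite {n\<in>N'. \<forall>v\<in>F. c n v = h v}"
      by (rule cluster_point[of c N' "l 0" "{l s}"]) (use cG N' bounded in simp_all)
    have near: "\<exists>n\<in>N'. \<forall>v\<in>F. c n v = h v" if "finite F" "F \<subseteq> V" for F
      using infinite_imp_nonempty[OF h(2)[OF that]] by auto
    have "\<exists>a\<in>W. \<forall>v\<in>F. a v = h v" if "finite F" "F \<subseteq> V" for F
      using near[OF that] cW by (elim bexE) (rule bexI)
    then have hW: "h \<in> W"
      using W(2) h(1) unfolding closedin_compact_open_iff by (simp del: ex_simps)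
    have "h (l i) = l (i + s)" for i
    proof -
      have "infinite {n\<in>N'. \<forall>v\<in>{l i}. c n v = h v}" by (intro h(2)) auto
      then obtain n where "n \<ge> nat (i - b)" "c n (l i) = h (l i)"
        unfolding infinite_nat_iff_unbounded_le by auto
      then show ?thesis using cl[of i n] by simp
    qed
    then have "end_act h (pos_end l) = pos_end l" using h(1) by (intro translation_fixes_ends(2)) auto
    then have "h = id" using W_free hW pos unfolding free_on_set_def by blast
    moreover obtain n where "n \<in> N'" "c n v = h v" using near[of "{v}"] v(1) by auto
    ultimately show False by (simp add: N'_def N_def)
  qed
  moreover have "u \<in> W" if u: "u \<in> end_radical (neg_end l)" for u
  proof -
    have uA: "u \<in> Aut" by (rule G_aut[OF end_radical_in_G[OF u]])
    have ul: "geodesic_line V E (u \<circ> l)" using uA line by (simp add: aut_line)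
    have "end_act u (pos_end l) \<noteq> neg_end l"
      using backward_asymptotic_pos_end_neq[OF line end_radical_fixes_end(1)[OF line u]] uA line
      by (simp add: end_act_pos_end)
    then have "end_act u (pos_end l) \<in> ends V E - {neg_end l}"
      using uA pos by (simp add: end_act_in_ends)
    then obtain w where w: "w \<in> W" "end_act w (pos_end l) = end_act u (pos_end l)"
      using W_trans pos unfolding transitive_on_set_def by blast
    have wA: "w \<in> Aut" by (rule G_aut[OF end_radical_in_G[OF sub[OF w(1)]]])
    have "inv_fun w \<circ> u \<in> end_radical (neg_end l)"
      by (intro end_radical_comp end_radical_inv u sub w(1))
    moreover have "end_act (inv_fun w \<circ> u) (pos_end l) = pos_end l"
      using wA w(2) by (simp add: end_act_comp end_act_inv)
    ultimately have "inv_fun w \<circ> u = id" using end_radical_free[OF trans closed] pos by blast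
    then have "inv_fun w (u v) = v" for v by (simp add: fun_eq_iff)
    then have "u v = w v" for v using aut_f_inv[OF wA, of "u v"] by simp
    then show ?thesis using w(1) by (metis ext)
  qed
  ultimately show ?thesis by blast
qed

end


section \<open>The system of root groups\<close>

lemma (in locally_finite_tree) hyperbolic_axis:
  assumes "hyperbolic V E \<alpha>"
  obtains l k where "geodesic_line V E l" "k > 0" "\<And>i. \<alpha> (l i) = l (i + k)"
proof -
  obtain l k where l: "geodesic_line V E l" "k \<noteq> 0" "\<And>i. \<alpha> (l i) = l (i + k)"
    using assms unfolding hyperbolic_def by auto
  \<comment> \<open>if \<open>\<alpha>\<close> translates in the negative direction, the axis is reversed\<close>
  show thesis
  proof (cases "k > 0")
    case True then show ?thesis using that l by blast
  next
    case False
    have "\<alpha> (l (- i)) = l (- (i + - k))" for i using l(3)[of "- i"] by simp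
    then show ?thesis using that[of "\<lambda>i. l (- i)" "- k"] line_reverse[OF l(1)] l(2) False by simp
  qed
qed

context tree_axis
begin

lemma conjugate_axis:
  assumes g: "g \<in> G"
  shows "tree_axis V E G (g \<circ> \<alpha> \<circ> inv_fun g) (g \<circ> l) k"
  by unfold_locales (use g line k_pos translation in \<open>simp_all add: aut_line\<close>)

lemma end_is_conjugate_neg_end:
  assumes trans: "transitive_on_set G (ends V E)" and "\<xi> \<in> ends V E"
  shows "\<exists>g\<in>G. end_act g (neg_end l) = \<xi> \<and> neg_end (g \<circ> l) = \<xi>"
  using assms neg_end_in[OF line] line unfolding transitive_on_set_def
  by (metis end_act_neg_end G_aut)

lemma closed_end_radical_conjugate:
  assumes "closedin (aut_topology V E) (end_radical (neg_end l))" and g: "g \<in> G"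
  shows "closedin (aut_topology V E) (end_radical (neg_end (g \<circ> l)))"
  using closedin_conj_by[OF G_aut[OF g] assms(1)] g line
  by (simp add: conj_end_radical end_act_neg_end)

proposition end_radical_sharply_transitive:
  assumes trans: "transitive_on_set G (ends V E)"
    and closed: "closedin (aut_topology V E) (end_radical (neg_end l))"
  shows "transitive_on_set (end_radical (neg_end l)) (ends V E - {neg_end l})"
    and "free_on_set (end_radical (neg_end l)) (ends V E - {neg_end l})"
proof -
  show "transitive_on_set (end_radical (neg_end l)) (ends V E - {neg_end l})"
    unfolding transitive_on_set_def
  proof (intro ballI)
    fix \<eta> \<zeta> assume "\<eta> \<in> ends V E - {neg_end l}" "\<zeta> \<in> ends V E - {neg_end l}"
    then obtain u w where u: "u \<in> end_radical (neg_end l)" "end_act u (pos_end l) = \<eta>"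
      and w: "w \<in> end_radical (neg_end l)" "end_act w (pos_end l) = \<zeta>"
      using end_radical_moves_axis[OF trans] by blast
    have uA: "u \<in> Aut" by (rule G_aut[OF end_radical_in_G[OF u(1)]])
    have "end_act (inv_fun u) \<eta> = pos_end l" using uA u(2) by (simp add: end_act_inv)
    then have "end_act (w \<circ> inv_fun u) \<eta> = \<zeta>" using w(2) by (simp add: end_act_comp)
    then show "\<exists>h\<in>end_radical (neg_end l). end_act h \<eta> = \<zeta>"
      using end_radical_comp[OF w(1) end_radical_inv[OF u(1)]] by blast
  qed
  show "free_on_set (end_radical (neg_end l)) (ends V E - {neg_end l})"
    unfolding free_on_set_def using end_radical_free[OF trans closed] by blast
qed

theorem root_group_system_end_radical:
  assumes trans: "transitive_on_set G (ends V E)"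
    and closed: "closedin (aut_topology V E) (end_radical (neg_end l))"
  shows "root_group_system V E G end_radical"
  unfolding root_group_system_def
proof (intro conjI ballI)
  fix \<xi> assume \<xi>: "\<xi> \<in> ends V E"
  obtain g where g: "g \<in> G" "neg_end (g \<circ> l) = \<xi>"
    using end_is_conjugate_neg_end[OF trans \<xi>] by blast
  have gl: "geodesic_line V E (g \<circ> l)" using g(1) line by (simp add: aut_line)
  show "subgroup (end_radical \<xi>) ((aut_group V E)\<lparr>carrier := G\<rparr>)"
    using end_radical_subgroup[OF gl] g(2) by simp
  show "closedin (aut_topology V E) (end_radical \<xi>)"
    using closed_end_radical_conjugate[OF closed g(1)] g(2) by simp
next
  have "end_radical ` ends V E = {conj_by V E g (end_radical (neg_end l)) | g. g \<in> G}"
  proof (intro equalityI subsetI)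
    fix U assume "U \<in> end_radical ` ends V E"
    then obtain \<xi> where \<xi>: "\<xi> \<in> ends V E" "U = end_radical \<xi>" by blast
    obtain g where "g \<in> G" "end_act g (neg_end l) = \<xi>"
      using end_is_conjugate_neg_end[OF trans \<xi>(1)] by blast
    then show "U \<in> {conj_by V E g (end_radical (neg_end l)) | g. g \<in> G}"
      using conj_end_radical \<xi>(2) by blast
  next
    fix U assume "U \<in> {conj_by V E g (end_radical (neg_end l)) | g. g \<in> G}"
    then obtain g where "g \<in> G" "U = end_radical (end_act g (neg_end l))"
      using conj_end_radical by blast
    then show "U \<in> end_radical ` ends V E"
      using end_act_in_ends[OF G_aut neg_end_in[OF line]] by blast
  qed
  then show "conjugacy_class_family V E G end_radical"
    unfolding conjugacy_class_family_def using end_radical_subgroup[OF line] by blast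
next
  show "moufang_condition V E end_radical"
    unfolding moufang_condition_def
  proof
    fix \<xi> assume \<xi>: "\<xi> \<in> ends V E"
    obtain g where g: "g \<in> G" "neg_end (g \<circ> l) = \<xi>"
      using end_is_conjugate_neg_end[OF trans \<xi>] by blast
    interpret conj: tree_axis V E G "g \<circ> \<alpha> \<circ> inv_fun g" "g \<circ> l" k
      by (rule conjugate_axis[OF g(1)])
    show "(\<forall>u\<in>end_radical \<xi>. end_act u \<xi> = \<xi>) \<and>
        transitive_on_set (end_radical \<xi>) (ends V E - {\<xi>}) \<and>
        free_on_set (end_radical \<xi>) (ends V E - {\<xi>})"
      using conj.end_radical_sharply_transitive[OF trans closed_end_radical_conjugate[OF closed g(1)]]
        end_radical_fixes_end(2)[OF conj.line] g(2) by simp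
  qed
qed

text \<open>
  The conjugate of the root group by \<open>\<alpha>\<close> is the root group of some end \<open>\<eta>\<close>, since root groups make up a
  conjugacy class, but a priori \<open>\<eta>\<close> may differ from \<open>neg_end l\<close>. If it does, then \<open>W \<eta>\<close> fixes the end
  \<open>neg_end l\<close> other than \<open>\<eta>\<close>, so it is trivial by freeness, and the claim holds trivially too. (This
  does occur: a line has two ends, and its root groups are trivial.)
\<close>

lemma root_group_translation_invariant:
  assumes W: "root_group_system V E G W" and w: "w \<in> W (neg_end l)"
  shows "\<alpha> \<circ> w \<circ> inv_fun \<alpha> \<in> W (neg_end l)"
proof -
  let ?\<xi> = "neg_end l"
  have \<xi>: "?\<xi> \<in> ends V E" by (rule neg_end_in[OF line])
  obtain H where H: "W ` ends V E = {conj_by V E g H | g. g \<in> G}"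
    using W unfolding root_group_system_def conjugacy_class_family_def by blast
  have fix_end: "end_act u \<eta> = \<eta>" if "\<eta> \<in> ends V E" "u \<in> W \<eta>" for \<eta> u
    using W that unfolding root_group_system_def moufang_condition_def by blast
  have trans: "transitive_on_set (W \<eta>) (ends V E - {\<eta>})"
    and free: "free_on_set (W \<eta>) (ends V E - {\<eta>})" if "\<eta> \<in> ends V E" for \<eta>
    using W that unfolding root_group_system_def moufang_condition_def by blast+
  have WG: "W \<eta> \<subseteq> G" if "\<eta> \<in> ends V E" for \<eta>
    using W that subgroup.subset unfolding root_group_system_def by fastforce
  obtain g where g: "g \<in> G" "W ?\<xi> = conj_by V E g H" using H \<xi> by blast
  have \<alpha>g: "\<alpha> \<circ> g \<in> G" using g(1) by simp
  have "conj_by V E (\<alpha> \<circ> g) H = (\<lambda>u. \<alpha> \<circ> u \<circ> inv_fun \<alpha>) ` W ?\<xi>"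
  proof -
    have "inv_fun (\<alpha> \<circ> g) = inv_fun g \<circ> inv_fun \<alpha>"
      using g(1) by (intro o_inv_distrib permutes_bij[of _ V] aut_permutes) simp_all
    then show ?thesis unfolding g(2) conj_by_eq[OF G_aut[OF g(1)]] conj_by_eq[OF G_aut[OF \<alpha>g]]
      by (simp add: image_image comp_assoc)
  qed
  moreover have "conj_by V E (\<alpha> \<circ> g) H \<in> W ` ends V E" using H \<alpha>g by blast
  ultimately obtain \<eta> where \<eta>: "\<eta> \<in> ends V E" "W \<eta> = (\<lambda>u. \<alpha> \<circ> u \<circ> inv_fun \<alpha>) ` W ?\<xi>" by auto
  have \<alpha>_\<xi>: "end_act \<alpha> ?\<xi> = ?\<xi>" by (rule translation_fixes_ends[of \<alpha> k]) (simp_all add: translation)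
  have \<eta>_fixes_\<xi>: "end_act u ?\<xi> = ?\<xi>" if u: "u \<in> W \<eta>" for u
  proof -
    obtain u' where u': "u' \<in> W ?\<xi>" "u = \<alpha> \<circ> u' \<circ> inv_fun \<alpha>" using u \<eta>(2) by blast
    have "end_act (inv_fun \<alpha>) ?\<xi> = ?\<xi>" using \<alpha>_\<xi> by (simp add: end_act_inv)
    then show ?thesis using fix_end[OF \<xi> u'(1)] \<alpha>_\<xi> unfolding u'(2) by (simp add: end_act_comp)
  qed
  show ?thesis
  proof (cases "\<eta> = ?\<xi>")
    case True
    then show ?thesis using \<eta>(2) w by blast
  next
    case False
    have "\<alpha> \<circ> w \<circ> inv_fun \<alpha> = id"
      using free[OF \<eta>(1)] \<eta>_fixes_\<xi> \<eta>(2) w \<xi> False unfolding free_on_set_def by blast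
    then have "\<alpha> (w (inv_fun \<alpha> (\<alpha> v))) = \<alpha> v" for v by (metis comp_apply id_apply)
    then have "w v = v" for v using aut_eq_iff[OF G_aut[OF \<alpha>_in_G]] by simp
    then have "w = id" by (simp add: fun_eq_iff)
    then show ?thesis using \<open>\<alpha> \<circ> w \<circ> inv_fun \<alpha> = id\<close> w by simp
  qed
qed

theorem root_group_system_unique:
  assumes trans: "transitive_on_set G (ends V E)"
    and closed: "closedin (aut_topology V E) (end_radical (neg_end l))"
    and W: "root_group_system V E G W"
  shows "W (neg_end l) = end_radical (neg_end l)"
proof (rule root_group_eq_end_radical[OF trans closed])
  let ?\<xi> = "neg_end l"
  have \<xi>: "?\<xi> \<in> ends V E" by (rule neg_end_in[OF line])
  show "W ?\<xi> \<subseteq> G" using W \<xi> subgroup.subset unfolding root_group_system_def by fastforce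
  show "closedin (aut_topology V E) (W ?\<xi>)" using W \<xi> unfolding root_group_system_def by blast
  show "transitive_on_set (W ?\<xi>) (ends V E - {?\<xi>})" "free_on_set (W ?\<xi>) (ends V E - {?\<xi>})"
    using W \<xi> unfolding root_group_system_def moufang_condition_def by blast+
  fix w assume w: "w \<in> W ?\<xi>"
  show "end_act w ?\<xi> = ?\<xi>"
    using W \<xi> w unfolding root_group_system_def moufang_condition_def by blast
  show "\<alpha> \<circ> w \<circ> inv_fun \<alpha> \<in> W ?\<xi>" by (rule root_group_translation_invariant[OF W w])
qed

end

theorem theorem3:
  fixes V :: "'v set" and E :: "('v \<times> 'v) set"
    and G :: "('v \<Rightarrow> 'v) set" and \<alpha> :: "'v \<Rightarrow> 'v"
  assumes "is_tree V E" and "locally_finite_graph V E" and "\<forall>v\<in>V. valency E v \<noteq> 1"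
    and "subgroup G (aut_group V E)" and "closedin (aut_topology V E) G"
    and "transitive_on_set G (ends V E)"
    and "\<alpha> \<in> G" and "hyperbolic V E \<alpha>"
    and "closedin (aut_topology V E) (contraction_group V E G \<alpha>)"
  shows "boundary_Moufang V E G \<and>
    (\<forall>W. root_group_system V E G W \<longrightarrow>
       (\<forall>\<xi>\<in>ends V E. \<exists>g\<in>G. W \<xi> = conj_by V E g (contraction_group V E G \<alpha>)))"
proof -
  interpret closed_tree_group V E G
    by (intro closed_tree_group.intro locally_finite_tree.intro closed_tree_group_axioms.intro
        assms(1,2,4,5))
  obtain l k where l: "geodesic_line V E l" "k > 0" "\<And>i. \<alpha> (l i) = l (i + k)"
    using hyperbolic_axis[OF assms(8)] by metis
  interpret tree_axis V E G \<alpha> l k by unfold_locales (use assms(7) l in simp_all)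
  let ?U = "contraction_group V E G \<alpha>"
  have U: "?U = end_radical (neg_end l)" by (rule contraction_group_eq_end_radical)
  have closed: "closedin (aut_topology V E) (end_radical (neg_end l))" using assms(9) U by simp
  have "boundary_Moufang V E G"
    unfolding boundary_Moufang_def
    using assms(4,5) root_group_system_end_radical[OF assms(6) closed] by blast
  moreover have "\<exists>g\<in>G. W \<xi> = conj_by V E g ?U"
    if W: "root_group_system V E G W" and \<xi>: "\<xi> \<in> ends V E" for W \<xi>
  proof -
    obtain g where g: "g \<in> G" "end_act g (neg_end l) = \<xi>" "neg_end (g \<circ> l) = \<xi>"
      using end_is_conjugate_neg_end[OF assms(6) \<xi>] by blast
    interpret conj: tree_axis V E G "g \<circ> \<alpha> \<circ> inv_fun g" "g \<circ> l" k
      by (rule conjugate_axis[OF g(1)])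
    have "W \<xi> = end_radical \<xi>"
      using conj.root_group_system_unique[OF assms(6) closed_end_radical_conjugate[OF closed g(1)] W]
        g(3) by simp
    then have "W \<xi> = conj_by V E g ?U" using conj_end_radical[OF g(1)] g(2) U by simp
    then show ?thesis using g(1) by blast
  qed
  ultimately show ?thesis by blast
qed

end
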